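(* Let $Y$ be a connected CW complex, let $Y^m$ denote its $m$-skeleton, and let $i_{Y^m}:Y^m\subset Y$ be the inclusion. For $n\le m$, $$\mathcal{G}_n(Y,Y^m;i_{Y^m})=\pi_n(Y).$$ In particular, $\mathcal{G}_*(Y,Y;\mathrm{id}_Y)=\pi_*(Y)$.
   Context: Here $n\ge 1$; maps and homotopies are pointed. For spaces $B,X$ let $i_X:X\to B\times X$, $i_X(x)=( *,x)$, and let $p_B:B\times X\to B$ be the projection; a section is a map $s:B\to B\times X$ with $p_B\circ s\simeq \mathrm{id}_B$. For a pointed map $f:X\to Y$, the $n$th relaxed evaluation subgroup $\mathcal{G}_n(Y,X;f)$ is the set of all $a\in\pi_n(Y)$ for which there exist a section $s:S^n\to S^n\times X$ and a map $F:S^n\times X\to Y$ such that $F\circ s\simeq a$ and $F\circ i_X\simeq f$. $\mathcal{G}_*$ denotes the collection of all $\mathcal{G}_n$, $n\geq 1$. *)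

theory Defs
  imports "HOL-Analysis.Analysis"
begin

definition disc :: "nat \<Rightarrow> (nat \<Rightarrow> real) topology" where
  "disc n = subtopology (Euclidean_space n) {x. (\<Sum>i<n. (x i)\<^sup>2) \<le> 1}"

definition disc_interior :: "nat \<Rightarrow> (nat \<Rightarrow> real) set" where
  "disc_interior n = {x \<in> topspace (disc n). (\<Sum>i<n. (x i)\<^sup>2) < 1}"

text \<open>For \<open>n = 0\<close> the disc is a single point, its interior is the whole disc, and its
  boundary is empty.\<close>

definition disc_boundary :: "nat \<Rightarrow> (nat \<Rightarrow> real) set" where
  "disc_boundary n = {x \<in> topspace (disc n). (\<Sum>i<n. (x i)\<^sup>2) = 1}"

text \<open>
  A CW structure on the space \<open>Y\<close> (J. H. C. Whitehead): \<open>C\<close> indexes the cells, \<open>d e\<close> is the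
  dimension of the cell \<open>e\<close> and \<open>\<Phi> e\<close> its characteristic map. Infinitely many cells and
  unbounded dimension are allowed.
\<close>

locale cw_complex =
  fixes Y :: "'a topology"
    and C :: "'i set"
    and d :: "'i \<Rightarrow> nat"
    and \<Phi> :: "'i \<Rightarrow> (nat \<Rightarrow> real) \<Rightarrow> 'a"
  assumes hausdorff: "Hausdorff_space Y"
    and characteristic_map: "e \<in> C \<Longrightarrow> continuous_map (disc (d e)) Y (\<Phi> e)"
    and open_cell:
      "e \<in> C \<Longrightarrow> homeomorphic_map (subtopology (disc (d e)) (disc_interior (d e)))
                     (subtopology Y (\<Phi> e ` disc_interior (d e))) (\<Phi> e)"
    and cells_disjoint: "disjoint_family_on (\<lambda>e. \<Phi> e ` disc_interior (d e)) C"
    and cells_cover: "topspace Y = (\<Union>e\<in>C. \<Phi> e ` disc_interior (d e))"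
    and closure_finite:
      "e \<in> C \<Longrightarrow> \<exists>K. finite K \<and> K \<subseteq> {e' \<in> C. d e' < d e} \<and>
                 \<Phi> e ` disc_boundary (d e) \<subseteq> (\<Union>e'\<in>K. \<Phi> e' ` disc_interior (d e'))"
    and weak_topology:
      "\<lbrakk>A \<subseteq> topspace Y;
        \<And>e. e \<in> C \<Longrightarrow> closedin Y (A \<inter> \<Phi> e ` topspace (disc (d e)))\<rbrakk> \<Longrightarrow> closedin Y A"

text \<open>As a space, the skeleton is given the subspace topology.\<close>

definition cw_skeleton ::
  "'i set \<Rightarrow> ('i \<Rightarrow> nat) \<Rightarrow> ('i \<Rightarrow> (nat \<Rightarrow> real) \<Rightarrow> 'a) \<Rightarrow> nat \<Rightarrow> 'a set" where
  "cw_skeleton C d \<Phi> m = (\<Union>e\<in>{e \<in> C. d e \<le> m}. \<Phi> e ` disc_interior (d e))"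

definition pointed_map ::
  "'a topology \<Rightarrow> 'a \<Rightarrow> 'b topology \<Rightarrow> 'b \<Rightarrow> ('a \<Rightarrow> 'b) \<Rightarrow> bool" where
  "pointed_map X x0 Y y0 f \<longleftrightarrow> continuous_map X Y f \<and> f x0 = y0"

definition pointed_homotopic ::
  "'a topology \<Rightarrow> 'a \<Rightarrow> 'b topology \<Rightarrow> 'b \<Rightarrow> ('a \<Rightarrow> 'b) \<Rightarrow> ('a \<Rightarrow> 'b) \<Rightarrow> bool" where
  "pointed_homotopic X x0 Y y0 = homotopic_with (\<lambda>h. h x0 = y0) X Y"

definition sphere_base :: "nat \<Rightarrow> real" where
  "sphere_base = (\<lambda>i. if i = 0 then 1 else 0)"

text \<open>
  The underlying set of \<open>\<pi>\<^sub>n(Y, y0)\<close>: pointed homotopy classes of pointed maps from the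
  \<open>n\<close>-sphere. Functions that agree on the sphere lie in the same class, so their values off
  the sphere are irrelevant.
\<close>

definition homotopy_group ::
  "nat \<Rightarrow> 'b topology \<Rightarrow> 'b \<Rightarrow> ((nat \<Rightarrow> real) \<Rightarrow> 'b) set set" where
  "homotopy_group n Y y0 =
     {f. pointed_map (nsphere n) sphere_base Y y0 f} //
     {(f, g). pointed_homotopic (nsphere n) sphere_base Y y0 f g}"

lemma equiv_pointed_homotopic:
  "equiv {f. pointed_map X x0 Y y0 f} {(f, g). pointed_homotopic X x0 Y y0 f g}"
  unfolding pointed_map_def pointed_homotopic_def
proof (rule equivI)
  show "{(f, g). homotopic_with (\<lambda>h. h x0 = y0) X Y f g}
        \<subseteq> {f. continuous_map X Y f \<and> f x0 = y0} \<times> {f. continuous_map X Y f \<and> f x0 = y0}"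
    by (auto dest: homotopic_with_imp_continuous_maps homotopic_with_imp_property)
  show "refl_on {f. continuous_map X Y f \<and> f x0 = y0}
          {(f, g). homotopic_with (\<lambda>h. h x0 = y0) X Y f g}"
    by (simp add: refl_on_def)
  show "sym {(f, g). homotopic_with (\<lambda>h. h x0 = y0) X Y f g}"
    unfolding sym_def using homotopic_with_symD by blast
  show "trans {(f, g). homotopic_with (\<lambda>h. h x0 = y0) X Y f g}"
    unfolding trans_def using homotopic_with_trans by blast
qed

definition is_section ::
  "'b topology \<Rightarrow> 'b \<Rightarrow> 'a topology \<Rightarrow> 'a \<Rightarrow> ('b \<Rightarrow> 'b \<times> 'a) \<Rightarrow> bool" where
  "is_section B b0 X x0 s \<longleftrightarrow>
     pointed_map B b0 (prod_topology B X) (b0, x0) s \<and>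
     pointed_homotopic B b0 B b0 (fst \<circ> s) id"

definition relaxed_evaluation ::
  "nat \<Rightarrow> 'b topology \<Rightarrow> 'b \<Rightarrow> 'a topology \<Rightarrow> 'a \<Rightarrow> ('a \<Rightarrow> 'b) \<Rightarrow>
     ((nat \<Rightarrow> real) \<Rightarrow> 'b) set set" where
  "relaxed_evaluation n Y y0 X x0 f =
     {a \<in> homotopy_group n Y y0. \<exists>s F.
        is_section (nsphere n) sphere_base X x0 s \<and>
        pointed_map (prod_topology (nsphere n) X) (sphere_base, x0) Y y0 F \<and>
        F \<circ> s \<in> a \<and>
        pointed_homotopic X x0 Y y0 (F \<circ> (\<lambda>x. (sphere_base, x))) f}"

end

theory Submission
  imports Defs
begin

text \<open>
  If a class in \<open>\<pi>\<^sub>n(Y)\<close> has a representative \<open>g\<close> with values in a subspace \<open>X\<close>, then the graph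
  \<open>s b = (b, g b)\<close> is a section of \<open>S\<^sup>n \<times> X \<rightarrow> S\<^sup>n\<close>, and the projection \<open>F (b, x) = x\<close> satisfies
  \<open>F \<circ> s = g\<close> and restricts to the inclusion of \<open>X\<close>. So the class lies in the relaxed
  evaluation subgroup (\<open>relaxed_evaluation_full\<close>). For \<open>X = Y\<close> there is nothing else to do. For
  the skeleton \<open>X = Y\<^sup>m\<close> the point is the surjectivity of \<open>\<pi>\<^sub>n(Y\<^sup>m) \<rightarrow> \<pi>\<^sub>n(Y)\<close> for \<open>n \<le> m\<close>,
  which is cellular approximation for maps from spheres (\<open>cellular_approximation\<close>).

  The image of \<open>f : S\<^sup>n \<rightarrow> Y\<close> is compact, hence lies in a finite subcomplex
  (\<open>compact_in_finite_subcomplex\<close>). Its cells of dimension above \<open>m\<close> are removed one at a time,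
  the largest dimension first. Let \<open>e\<close> be such a cell, of dimension \<open>k > n\<close>. Over the inner part
  of \<open>e\<close> the map is a family of \<open>k\<close> real functions. Near the centre it is deformed to a Lipschitz map that avoids
  the centre of \<open>e\<close> (\<open>homotope_off_center\<close>), and then radial projection moves the image into the
  boundary of \<open>e\<close> (\<open>push_to_boundary\<close>). Both homotopies fix every point whose image is outside
  the open cell \<open>e\<close>, in particular the base point, because \<open>y0\<close> lies in the \<open>m\<close>-skeleton.

  A Lipschitz map \<open>S\<^sup>n \<rightarrow> \<real>\<^sup>k\<close> with \<open>n < k\<close> misses points arbitrarily close to \<open>0\<close> by counting
  (\<open>lipschitz_sphere_image_misses\<close>): the sphere is covered by \<open>O(N\<^sup>n)\<close> sets of diameter
  \<open>O(1/N)\<close>, but a grid of mesh a large multiple of \<open>1/N\<close> in a \<open>k\<close>-cube has about \<open>N\<^sup>k\<close> points,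
  and two grid points cannot be hit by the same small set. This works uniformly in \<open>n\<close> and \<open>k\<close>
  inside the single metric space \<open>nat \<Rightarrow> real\<close>, with no measure and no smoothness.
\<close>

section \<open>Lipschitz maps from the sphere into higher dimensions\<close>

text \<open>
  The weights \<open>(1/2)^n\<close> in the metric of a countable product add up to \<open>2\<close>, whichever enumeration
  of the index type is used.
\<close>

lemma dist_fun_le:
  fixes x y :: "'i::countable \<Rightarrow> 'b::metric_space"
  assumes "\<And>i. dist (x i) (y i) \<le> b"
  shows "dist x y \<le> 2 * b"
proof -
  let ?g = "\<lambda>n. (1/2::real) ^ n"
  have sg: "summable ?g" by (simp add: summable_geometric)
  have "dist x y \<le> (\<Sum>n. ?g n * b)"
    unfolding dist_fun_def
  proof (rule suminf_le)
    show "?g n * min (dist (x (from_nat n)) (y (from_nat n))) 1 \<le> ?g n * b" for n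
      using assms[of "from_nat n"] by (intro mult_left_mono) auto
    show "summable (\<lambda>n. ?g n * min (dist (x (from_nat n)) (y (from_nat n))) 1)"
      by (rule summable_comparison_test'[OF sg]) auto
    show "summable (\<lambda>n. ?g n * b)"
      using sg by (rule summable_mult2)
  qed
  also have "\<dots> = 2 * b"
    using suminf_mult2[OF sg, of b] suminf_geometric[of "1/2::real"] by simp
  finally show ?thesis .
qed

text \<open>
  The approximation is the inf-convolution \<open>w x = (INF y\<in>A. u y + L * dist x y)\<close>. As an infimum of
  \<open>L\<close>-Lipschitz functions it is \<open>L\<close>-Lipschitz, and it is at most \<open>u\<close> on \<open>A\<close>. When \<open>L\<close> is large, points
  \<open>y\<close> far from \<open>x\<close> do not compete in the infimum, and near \<open>x\<close> the values of \<open>u\<close> differ by less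
  than \<open>e\<close>.
\<close>

lemma lipschitz_approximation:
  fixes u :: "'a::metric_space \<Rightarrow> real"
  assumes A: "compact A" and u: "continuous_on A u" and e: "e > 0"
  shows "\<exists>L w. L-lipschitz_on UNIV w \<and> (\<forall>x\<in>A. \<bar>w x - u x\<bar> \<le> e)"
proof (cases "A = {}")
  case True
  have "0-lipschitz_on UNIV (\<lambda>x::'a. 0::real)" by (simp add: lipschitz_on_def)
  then show ?thesis using True by blast
next
  case False
  have "compact (u ` A)" using A u compact_continuous_image by blast
  then obtain M where M: "\<And>x. x \<in> A \<Longrightarrow> \<bar>u x\<bar> \<le> M"
    using compact_imp_bounded[of "u ` A"] by (auto simp: bounded_iff)
  then have M0: "0 \<le> M" using False by (metis abs_ge_zero all_not_in_conv order_trans)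
  obtain r where r: "r > 0" "\<And>x y. \<lbrakk>x \<in> A; y \<in> A; dist y x < r\<rbrakk> \<Longrightarrow> dist (u y) (u x) < e"
    using compact_uniformly_continuous[OF u A] e unfolding uniformly_continuous_on_def by metis
  \<comment> \<open>A point at distance at least \<open>r\<close> costs \<open>2 * M\<close>, which is the largest possible gain in \<open>u\<close>.\<close>
  define L where "L = 2 * M / r"
  have L0: "0 \<le> L" using M0 r by (simp add: L_def)
  define w where "w = (\<lambda>x. INF y\<in>A. u y + L * dist x y)"
  have bdd: "bdd_below ((\<lambda>y. u y + L * dist x y) ` A)" for x
  proof (rule bdd_belowI2)
    fix y assume "y \<in> A"
    show "- M \<le> u y + L * dist x y"
      using M[OF \<open>y \<in> A\<close>] L0 mult_nonneg_nonneg[OF L0 zero_le_dist, of x y] by linarith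
  qed
  have le: "w x \<le> w x' + L * dist x x'" for x x'
  proof -
    have "w x - L * dist x x' \<le> w x'"
      unfolding w_def
    proof (rule cINF_greatest[OF False])
      fix y assume y: "y \<in> A"
      have "(INF y\<in>A. u y + L * dist x y) \<le> u y + L * dist x y"
        by (rule cINF_lower[OF bdd y])
      also have "\<dots> \<le> u y + L * (dist x x' + dist x' y)"
        using L0 by (intro add_left_mono mult_left_mono dist_triangle)
      finally show "(INF y\<in>A. u y + L * dist x y) - L * dist x x' \<le> u y + L * dist x' y"
        by (simp add: algebra_simps)
    qed
    then show ?thesis by simp
  qed
  have "L-lipschitz_on UNIV w"
  proof (rule lipschitz_onI[OF _ L0])
    fix x y
    show "dist (w x) (w y) \<le> L * dist x y"
      using le[of x y] le[of y x] by (simp add: dist_real_def dist_commute)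
  qed
  moreover have "\<bar>w x - u x\<bar> \<le> e" if x: "x \<in> A" for x
  proof -
    have "w x \<le> u x" using cINF_lower[OF bdd[of x] x] by (simp add: w_def)
    moreover have "u x - e \<le> w x"
      unfolding w_def
    proof (rule cINF_greatest[OF False])
      fix y assume y: "y \<in> A"
      show "u x - e \<le> u y + L * dist x y"
      proof (cases "dist y x < r")
        case True
        then show ?thesis using r(2)[OF x y True] mult_nonneg_nonneg[OF L0 zero_le_dist, of x y]
          by (simp add: dist_real_def)
      next
        case False
        then have "L * r \<le> L * dist x y" using L0 by (intro mult_left_mono) (auto simp: dist_commute)
        then have "2 * M \<le> L * dist x y" using r by (simp add: L_def)
        then show ?thesis using M[OF x] M[OF y] e by linarith
      qed
    qed
    ultimately show ?thesis by linarith
  qed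
  ultimately show ?thesis by blast
qed

lemma topspace_nsphere:
  "topspace (nsphere n) = {x. (\<Sum>i\<le>n. (x i)\<^sup>2) = 1 \<and> (\<forall>i>n. x i = 0)}"
  by (auto simp: nsphere)

text \<open>
  A point of the sphere has a coordinate \<open>i\<close> of size at least \<open>1 / (n + 1)\<close>, and the other \<open>n\<close>
  coordinates determine it up to the sign of that one, in a Lipschitz manner. The code of a point
  records \<open>i\<close>, the sign, and the other coordinates rounded to multiples of \<open>1 / N\<close>. The sets of the
  cover are the fibres of the code.
\<close>

lemma sphere_cover:
  fixes N n :: nat
  assumes N: "N \<ge> 1"
  shows "\<exists>(code :: (nat \<Rightarrow> real) \<Rightarrow> nat \<times> bool \<times> (nat \<Rightarrow> int)) Q.
    finite Q \<and> card Q \<le> 2 * (n + 1) * (3 * N) ^ n \<and> code ` topspace (nsphere n) \<subseteq> Q \<and>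
    (\<forall>x\<in>topspace (nsphere n). \<forall>y\<in>topspace (nsphere n).
       code x = code y \<longrightarrow> dist x y \<le> 2 * (real n + 1)\<^sup>2 / real N)"
proof -
  let ?S = "topspace (nsphere n)"
  define big where "big = (\<lambda>x::nat \<Rightarrow> real. SOME i. i \<le> n \<and> 1 / (real n + 1) \<le> \<bar>x i\<bar>)"
  have le1: "\<bar>x i\<bar> \<le> 1" if "x \<in> ?S" for x i
  proof (cases "i \<le> n")
    case True
    then have "(x i)\<^sup>2 \<le> (\<Sum>i\<le>n. (x i)\<^sup>2)"
      by (intro member_le_sum) auto
    then show ?thesis using that by (simp add: topspace_nsphere abs_square_le_1)
  qed (use that in \<open>auto simp: topspace_nsphere\<close>)
  have big: "big x \<le> n \<and> 1 / (real n + 1) \<le> \<bar>x (big x)\<bar>" if x: "x \<in> ?S" for x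
  proof -
    have "\<exists>i. i \<le> n \<and> 1 / (real n + 1) \<le> \<bar>x i\<bar>"
    proof (rule ccontr)
      assume "\<not> ?thesis"
      then have *: "\<bar>x i\<bar> < 1 / (real n + 1)" if "i \<le> n" for i using that by force
      have "1 = (\<Sum>i\<le>n. (x i)\<^sup>2)" using x by (simp add: topspace_nsphere)
      also have "\<dots> \<le> (\<Sum>i\<le>n. \<bar>x i\<bar>)"
      proof (rule sum_mono)
        fix i
        show "(x i)\<^sup>2 \<le> \<bar>x i\<bar>"
          using mult_left_mono[OF le1[OF x, of i] abs_ge_zero[of "x i"]]
          by (simp only: power2_eq_square abs_mult_self_eq mult_1_right)
      qed
      also have "\<dots> < (\<Sum>i\<le>n. 1 / (real n + 1))"
        using * by (intro sum_strict_mono) auto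
      finally show False by simp
    qed
    then show ?thesis unfolding big_def by (rule someI_ex)
  qed
  define code where "code = (\<lambda>x::nat \<Rightarrow> real. (big x, x (big x) > 0,
     \<lambda>j. if j \<le> n then if j = big x then 0 else \<lfloor>real N * x j\<rfloor> else undefined))"
  define R where "R = (\<lambda>i. PiE {..n} (\<lambda>j. if j = i then {0} else {- int N..int N}))"
  define Q where "Q = (SIGMA i:{..n}. (UNIV :: bool set) \<times> R i)"
  have finR: "finite (R i)" for i unfolding R_def by (rule finite_PiE) auto
  then have finQ: "finite Q" by (simp add: Q_def)
  have cardR: "card (R i) \<le> (3 * N) ^ n" if "i \<le> n" for i
  proof -
    have "card (R i) = (\<Prod>j\<le>n. card (if j = i then {0} else {- int N..int N}))"
      unfolding R_def by (rule card_PiE) auto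
    also have "\<dots> = (\<Prod>j\<le>n. if j = i then 1 else 2 * N + 1)"
      by (rule prod.cong) auto
    also have "\<dots> = (\<Prod>j\<in>{..n} - {i}. 2 * N + 1)"
      using that by (subst prod.remove[of _ i]) (auto intro!: prod.cong)
    also have "\<dots> = (2 * N + 1) ^ n" using that by simp
    also have "\<dots> \<le> (3 * N) ^ n" using N by (intro power_mono) auto
    finally show ?thesis .
  qed
  have "card Q = (\<Sum>i\<le>n. 2 * card (R i))"
    using finR by (simp add: Q_def card_SigmaI card_cartesian_product)
  also have "\<dots> \<le> (\<Sum>i\<le>n. 2 * (3 * N) ^ n)"
    using cardR by (intro sum_mono) auto
  also have "\<dots> = 2 * (n + 1) * (3 * N) ^ n" by simp
  finally have cardQ: "card Q \<le> 2 * (n + 1) * (3 * N) ^ n" .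
  have "code x \<in> Q" if x: "x \<in> ?S" for x
  proof -
    have "- int N \<le> \<lfloor>real N * x j\<rfloor> \<and> \<lfloor>real N * x j\<rfloor> \<le> int N" for j
    proof -
      have "\<bar>real N * x j\<bar> \<le> real N"
        using le1[OF x, of j] by (simp add: abs_mult mult_left_le)
      then show ?thesis by linarith
    qed
    then show ?thesis using big[OF x] by (auto simp: code_def Q_def R_def split: if_splits)
  qed
  moreover have "dist x y \<le> 2 * (real n + 1)\<^sup>2 / real N"
    if x: "x \<in> ?S" and y: "y \<in> ?S" and eq: "code x = code y" for x y
  proof -
    define i where "i = big x"
    have i: "big y = i" "i \<le> n" "1 / (real n + 1) \<le> \<bar>x i\<bar>" "1 / (real n + 1) \<le> \<bar>y i\<bar>"
      and sg: "0 < x i \<longleftrightarrow> 0 < y i"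
      using eq big[OF x] big[OF y] by (auto simp: code_def i_def)
    have small: "\<bar>x j - y j\<bar> \<le> 1 / real N" if "j \<noteq> i" for j
    proof (cases "j \<le> n")
      case True
      have "\<lfloor>real N * x j\<rfloor> = \<lfloor>real N * y j\<rfloor>"
      proof -
        have "snd (snd (code x)) j = snd (snd (code y)) j" using eq by simp
        then show ?thesis using True that i(1) by (simp add: code_def i_def[symmetric])
      qed
      then have "\<bar>real N * x j - real N * y j\<bar> \<le> 1" by linarith
      then have "real N * \<bar>x j - y j\<bar> \<le> 1" by (simp add: abs_mult flip: right_diff_distrib)
      then show ?thesis using N by (simp add: field_simps)
    qed (use x y in \<open>auto simp: topspace_nsphere\<close>)
    have "\<bar>x i - y i\<bar> \<le> real n * (real n + 1) / real N"
    proof -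
      \<comment> \<open>The equation of the sphere bounds \<open>(x i)\<^sup>2 - (y i)\<^sup>2\<close> by the other coordinates. Dividing by
          \<open>x i + y i\<close> is harmless because both terms have the same sign and are large.\<close>
      have "(x i)\<^sup>2 - (y i)\<^sup>2 = - (\<Sum>j\<in>{..n} - {i}. (x j)\<^sup>2 - (y j)\<^sup>2)"
      proof -
        have "(\<Sum>j\<le>n. (x j)\<^sup>2 - (y j)\<^sup>2) = 0"
          using x y by (simp add: topspace_nsphere sum_subtractf)
        then show ?thesis
          using i(2) by (subst (asm) sum.remove[of _ i]) auto
      qed
      then have "\<bar>(x i)\<^sup>2 - (y i)\<^sup>2\<bar> \<le> (\<Sum>j\<in>{..n} - {i}. \<bar>(x j)\<^sup>2 - (y j)\<^sup>2\<bar>)"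
        by simp
      also have "\<dots> \<le> (\<Sum>j\<in>{..n} - {i}. 2 / real N)"
      proof (rule sum_mono)
        fix j assume "j \<in> {..n} - {i}"
        then have "\<bar>x j - y j\<bar> \<le> 1 / real N" using small by auto
        moreover have "\<bar>x j + y j\<bar> \<le> 2" using le1[OF x, of j] le1[OF y, of j] by linarith
        ultimately have "\<bar>x j - y j\<bar> * \<bar>x j + y j\<bar> \<le> (1 / real N) * 2"
          by (intro mult_mono) auto
        then show "\<bar>(x j)\<^sup>2 - (y j)\<^sup>2\<bar> \<le> 2 / real N"
          by (simp add: power2_eq_square square_diff_square_factored abs_mult mult.commute)
      qed
      also have "\<dots> = 2 * real n / real N" using i(2) by simp
      finally have 1: "\<bar>x i - y i\<bar> * \<bar>x i + y i\<bar> \<le> 2 * real n / real N"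
        by (simp add: power2_eq_square square_diff_square_factored abs_mult mult.commute)
      have "2 / (real n + 1) \<le> \<bar>x i + y i\<bar>"
        using i(3,4) sg by (cases "0 < x i") auto
      then have "\<bar>x i - y i\<bar> * (2 / (real n + 1)) \<le> \<bar>x i - y i\<bar> * \<bar>x i + y i\<bar>"
        by (intro mult_left_mono) auto
      then have "\<bar>x i - y i\<bar> * (2 / (real n + 1)) \<le> 2 * real n / real N" using 1 by linarith
      then show ?thesis using N by (simp add: field_simps)
    qed
    also have "\<dots> \<le> (real n + 1)\<^sup>2 / real N"
      by (intro divide_right_mono) (auto simp: power2_eq_square algebra_simps)
    finally have bi: "\<bar>x i - y i\<bar> \<le> (real n + 1)\<^sup>2 / real N" .
    have "1 / real N \<le> (real n + 1)\<^sup>2 / real N"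
      by (intro divide_right_mono) (auto simp: power2_eq_square algebra_simps)
    then have "\<bar>x j - y j\<bar> \<le> (real n + 1)\<^sup>2 / real N" for j
      using bi small[of j] by (cases "j = i") auto
    then show ?thesis using dist_fun_le[of x y "(real n + 1)\<^sup>2 / real N"]
      by (simp add: dist_real_def)
  qed
  ultimately show ?thesis using finQ cardQ by blast
qed

text \<open>
  Pigeonhole: otherwise each of the \<open>M ^ k\<close> points of a grid of mesh \<open>r / M\<close> in \<open>[0, r]\<^sup>k\<close> is a value of
  \<open>w\<close>. Choose one preimage of each and a cover of the sphere into sets so small that \<open>w\<close> moves less
  than one mesh on each. Then different grid points use different sets, but there are only
  \<open>O(M ^ n)\<close> sets.
\<close>

lemma lipschitz_sphere_image_misses:
  fixes w :: "nat \<Rightarrow> (nat \<Rightarrow> real) \<Rightarrow> real"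
  assumes nk: "n < k" and r: "r > 0"
    and w: "\<And>i. i < k \<Longrightarrow> \<exists>L. L-lipschitz_on (topspace (nsphere n)) (w i)"
  shows "\<exists>c. (\<forall>i<k. \<bar>c i\<bar> \<le> r) \<and> (\<forall>x\<in>topspace (nsphere n). \<exists>i<k. w i x \<noteq> c i)"
proof (rule ccontr)
  let ?S = "topspace (nsphere n)"
  assume neg: "\<not> ?thesis"
  obtain L' where L': "\<And>i. i < k \<Longrightarrow> (L' i)-lipschitz_on ?S (w i)" using w by metis
  define L where "L = (\<Sum>i<k. \<bar>L' i\<bar>)"
  have L0: "L \<ge> 0" by (simp add: L_def sum_nonneg)
  have L: "\<bar>w i x - w i y\<bar> \<le> L * dist x y" if "i < k" "x \<in> ?S" "y \<in> ?S" for i x y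
  proof -
    have "\<bar>w i x - w i y\<bar> \<le> L' i * dist x y"
      using lipschitz_onD[OF L'[OF that(1)] that(2,3)] by (simp add: dist_real_def)
    also have "L' i \<le> \<bar>L' i\<bar>" by simp
    also have "\<bar>L' i\<bar> \<le> L" unfolding L_def using that(1) by (intro member_le_sum) auto
    finally show ?thesis by (simp add: mult_right_mono)
  qed
  define B where "B = 2 * (real n + 1)\<^sup>2"
  \<comment> \<open>The cover of fineness \<open>N = q * M\<close> has sets of diameter \<open>B / (q * M)\<close>, on which \<open>w\<close> varies by
      less than the mesh \<open>r / M\<close>. It has at most \<open>A * M ^ n\<close> sets, and \<open>M = A + 1\<close> makes this less
      than \<open>M ^ k\<close>.\<close>
  obtain q :: nat where q: "q \<ge> 1" "L * B / r < real q"
  proof -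
    obtain q :: nat where "L * B / r < real q" using reals_Archimedean2 by blast
    then show ?thesis using that[of "Suc q"] by auto
  qed
  define A where "A = 2 * (n + 1) * (3 * q) ^ n"
  define M where "M = A + 1"
  have M: "M \<ge> 1" by (simp add: M_def)
  obtain code :: "(nat \<Rightarrow> real) \<Rightarrow> nat \<times> bool \<times> (nat \<Rightarrow> int)" and Q where
    Q: "finite Q" "card Q \<le> 2 * (n + 1) * (3 * (q * M)) ^ n" "code ` ?S \<subseteq> Q"
    and code: "\<And>x y. \<lbrakk>x \<in> ?S; y \<in> ?S; code x = code y\<rbrakk> \<Longrightarrow> dist x y \<le> B / real (q * M)"
    using sphere_cover[of "q * M" n] q M unfolding B_def by (auto simp: mult.assoc)
  define J where "J = PiE {..<k} (\<lambda>_. {..<M})"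
  have cJ: "card J = M ^ k" by (simp add: J_def card_PiE)
  have finJ: "finite J" unfolding J_def by (rule finite_PiE) auto
  have "\<exists>x\<in>?S. \<forall>i<k. w i x = r * real (j i) / real M" if "j \<in> J" for j
  proof -
    have "\<bar>r * real (j i) / real M\<bar> \<le> r" if "i < k" for i
    proof -
      have "j i < M" using \<open>j \<in> J\<close> that by (auto simp: J_def)
      then show ?thesis using r by (auto simp: field_simps)
    qed
    then show ?thesis using neg by (auto dest!: spec[of _ "\<lambda>i. r * real (j i) / real M"])
  qed
  then obtain p where p: "\<And>j. j \<in> J \<Longrightarrow> p j \<in> ?S"
    "\<And>j i. \<lbrakk>j \<in> J; i < k\<rbrakk> \<Longrightarrow> w i (p j) = r * real (j i) / real M"
    by metis
  have inj: "inj_on (code \<circ> p) J"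
  proof (rule inj_onI)
    fix j j' assume j: "j \<in> J" and j': "j' \<in> J" and eq: "(code \<circ> p) j = (code \<circ> p) j'"
    have "j i = j' i" if i: "i < k" for i
    proof (rule ccontr)
      assume ne: "j i \<noteq> j' i"
      have "\<bar>w i (p j) - w i (p j')\<bar> \<le> L * dist (p j) (p j')"
        using L i p j j' by blast
      also have "\<dots> \<le> L * (B / real (q * M))"
        using code[OF p(1)[OF j] p(1)[OF j']] eq L0 by (intro mult_left_mono) auto
      also have "\<dots> < r / real M"
        using q M r by (simp add: field_simps)
      finally have "r / real M * \<bar>real (j i) - real (j' i)\<bar> < r / real M"
        using r p(2)[OF j i] p(2)[OF j' i]
        by (simp add: abs_mult flip: right_diff_distrib diff_divide_distrib)
      moreover have "1 \<le> \<bar>real (j i) - real (j' i)\<bar>" using ne by linarith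
      moreover have "0 < r / real M" using r M by simp
      ultimately show False using mult_left_mono[of 1 "\<bar>real (j i) - real (j' i)\<bar>" "r / real M"] by linarith
    qed
    then show "j = j'" using j j' unfolding J_def by (intro PiE_ext[of j _ _ j']) auto
  qed
  have "M ^ k \<le> card Q"
    using card_inj_on_le[OF inj _ Q(1)] p(1) Q(3) cJ by auto
  also have "\<dots> \<le> A * M ^ n" using Q(2) by (simp add: A_def power_mult_distrib ac_simps)
  also have "\<dots> < M * M ^ n" using M by (simp add: M_def)
  also have "\<dots> = M ^ Suc n" by simp
  also have "\<dots> \<le> M ^ k" using nk M by (intro power_increasing) auto
  finally show False by simp
qed

section \<open>The sphere and the disc as metric spaces\<close>

lemma topspace_disc: "topspace (disc k) = {x. L2_set x {..<k} \<le> 1 \<and> (\<forall>i\<ge>k. x i = 0)}"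
  by (auto simp: disc_def Euclidean_space_def L2_set_def)

lemma disc_eq_top_of_set: "disc k = top_of_set (topspace (disc k))"
  by (simp add: disc_def Euclidean_space_def subtopology_subtopology euclidean_product_topology)

lemma disc_interior_eq: "disc_interior k = {x. L2_set x {..<k} < 1 \<and> (\<forall>i\<ge>k. x i = 0)}"
  by (auto simp: disc_interior_def topspace_disc L2_set_def)

lemma disc_boundary_eq: "disc_boundary k = {x. L2_set x {..<k} = 1 \<and> (\<forall>i\<ge>k. x i = 0)}"
  by (auto simp: disc_boundary_def topspace_disc L2_set_def)

lemma topspace_disc_Un: "topspace (disc k) = disc_interior k \<union> disc_boundary k"
  by (auto simp: topspace_disc disc_interior_eq disc_boundary_eq)

lemma nsphere_eq_top_of_set: "nsphere n = top_of_set (topspace (nsphere n))"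
  by (simp add: nsphere euclidean_product_topology)

lemma pointed_homotopic_nsphereI:
  assumes H: "continuous_map (prod_topology (top_of_set {0..1::real}) (nsphere n)) Y H"
    and "\<And>x. x \<in> topspace (nsphere n) \<Longrightarrow> H (0, x) = f x"
    and "\<And>x. x \<in> topspace (nsphere n) \<Longrightarrow> H (1, x) = g x"
    and "\<And>t. t \<in> {0..1} \<Longrightarrow> H (t, sphere_base) = y0"
  shows "pointed_homotopic (nsphere n) sphere_base Y y0 f g"
proof -
  have base: "sphere_base \<in> topspace (nsphere n)"
    unfolding sphere_base_def by (rule in_topspace_nsphere)
  show ?thesis
    unfolding pointed_homotopic_def
    by (subst homotopic_with) (use assms base in auto)
qed

lemma continuous_on_coordinate: "continuous_on A (\<lambda>x::nat \<Rightarrow> real. x i)"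
  by (rule continuous_on_subset[OF continuous_on_product_coordinates]) simp

lemma continuous_on_L2_set:
  assumes "\<And>i. i \<in> I \<Longrightarrow> continuous_on A (\<lambda>x. f x i)"
  shows "continuous_on A (\<lambda>x. L2_set (f x) I)"
  unfolding L2_set_def using assms by (intro continuous_intros) auto

lemma compact_bounded_coordinates:
  assumes "closed A" and "\<And>x i. x \<in> A \<Longrightarrow> \<bar>x i\<bar> \<le> b"
  shows "compact (A :: (nat \<Rightarrow> real) set)"
proof -
  have "compactin (product_topology (\<lambda>_. euclideanreal) UNIV) (PiE UNIV (\<lambda>_::nat. {-b..b}))"
    by (simp add: compactin_PiE)
  then have "compact (PiE UNIV (\<lambda>_::nat. {-b..b}))"
    by (simp add: euclidean_product_topology)
  moreover have "A = A \<inter> PiE UNIV (\<lambda>_::nat. {-b..b})"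
    using assms(2) by (force simp: abs_le_iff)
  ultimately show ?thesis using assms(1) by (metis closed_Int_compact)
qed

lemma compact_disc: "compact (topspace (disc k))"
proof (rule compact_bounded_coordinates)
  have "topspace (disc k) = {x. L2_set x {..<k} \<le> 1} \<inter> (\<Inter>i\<in>{k..}. {x. x i = 0})"
    by (auto simp: topspace_disc)
  moreover have "closed {x::nat \<Rightarrow> real. L2_set x {..<k} \<le> 1}"
    by (intro closed_Collect_le continuous_on_L2_set continuous_on_coordinate continuous_intros)
  moreover have "closed {x::nat \<Rightarrow> real. x i = 0}" for i
    by (intro closed_Collect_eq continuous_on_coordinate continuous_intros)
  ultimately show "closed (topspace (disc k))" by (simp add: closed_INT closed_Int)
next
  fix x :: "nat \<Rightarrow> real" and i assume x: "x \<in> topspace (disc k)"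
  show "\<bar>x i\<bar> \<le> 1"
  proof (cases "i < k")
    case True
    have "\<bar>x i\<bar> \<le> L2_set x {..<k}"
      using member_le_L2_set[of "{..<k}" i "\<lambda>j. \<bar>x j\<bar>"] True by (simp add: L2_set_def)
    then show ?thesis using x by (simp add: topspace_disc)
  qed (use x in \<open>simp add: topspace_disc\<close>)
qed

lemma compact_nsphere: "compact (topspace (nsphere n))"
proof (rule compact_bounded_coordinates)
  have "topspace (nsphere n) = {x. (\<Sum>i\<le>n. (x i)\<^sup>2) = 1} \<inter> (\<Inter>i\<in>{n<..}. {x. x i = 0})"
    by (auto simp: topspace_nsphere)
  moreover have "closed {x::nat \<Rightarrow> real. (\<Sum>i\<le>n. (x i)\<^sup>2) = 1}"
    by (intro closed_Collect_eq continuous_on_coordinate continuous_intros)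
  moreover have "closed {x::nat \<Rightarrow> real. x i = 0}" for i
    by (intro closed_Collect_eq continuous_on_coordinate continuous_intros)
  ultimately show "closed (topspace (nsphere n))" by (simp add: closed_INT closed_Int)
next
  fix x :: "nat \<Rightarrow> real" and i assume x: "x \<in> topspace (nsphere n)"
  show "\<bar>x i\<bar> \<le> 1"
  proof (cases "i \<le> n")
    case True
    then have "(x i)\<^sup>2 \<le> (\<Sum>i\<le>n. (x i)\<^sup>2)"
      by (intro member_le_sum) auto
    then show ?thesis using x by (simp add: topspace_nsphere abs_square_le_1)
  qed (use x in \<open>auto simp: topspace_nsphere\<close>)
qed

section \<open>Finite subcomplexes\<close>

context cw_complex
begin

abbreviation cell :: "'i \<Rightarrow> 'a set" where
  "cell e \<equiv> \<Phi> e ` disc_interior (d e)"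

definition cells_union :: "'i set \<Rightarrow> 'a set" where
  "cells_union K = (\<Union>e\<in>K. cell e)"

text \<open>
  The boundary of a cell must be covered by cells in \<open>K\<close> of \<^emph>\<open>smaller\<close> dimension, as in the axiom
  of closure finiteness, so that \<open>K\<close> without a cell of largest dimension is again a subcomplex.
\<close>

definition subcomplex :: "'i set \<Rightarrow> bool" where
  "subcomplex K \<longleftrightarrow> K \<subseteq> C \<and>
     (\<forall>e\<in>K. \<Phi> e ` disc_boundary (d e) \<subseteq> cells_union {e' \<in> K. d e' < d e})"

lemma cell_unique: "\<lbrakk>e \<in> C; e' \<in> C; y \<in> cell e; y \<in> cell e'\<rbrakk> \<Longrightarrow> e = e'"
  using cells_disjoint unfolding disjoint_family_on_def by blast

lemma compactin_cell_image:
  assumes "e \<in> C" "compact A" "A \<subseteq> topspace (disc (d e))"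
  shows "compactin Y (\<Phi> e ` A)"
proof -
  have "compactin (disc (d e)) A"
    by (subst disc_eq_top_of_set) (use assms in \<open>simp add: compactin_subtopology\<close>)
  then show ?thesis using characteristic_map[OF assms(1)] image_compactin by blast
qed

text \<open>
  Pick one point of \<open>T\<close> in each cell that meets \<open>T\<close>. A closed cell meets only finitely many open cells,
  so every set of picked points is closed in the weak topology. An infinite set of them would
  have no accumulation point, which contradicts the compactness of \<open>T\<close>.
\<close>

lemma finite_cells_meeting_compact:
  assumes T: "compactin Y T"
  shows "finite {e \<in> C. T \<inter> cell e \<noteq> {}}" (is "finite ?E")
proof -
  have "\<forall>e\<in>?E. \<exists>y. y \<in> T \<and> y \<in> cell e" by blast
  then obtain p where p: "\<And>e. e \<in> ?E \<Longrightarrow> p e \<in> T \<and> p e \<in> cell e"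
    using bchoice[of ?E "\<lambda>e y. y \<in> T \<and> y \<in> cell e"] by blast
  have Ttop: "T \<subseteq> topspace Y" using T compactin_subset_topspace by blast
  have clo: "closedin Y Q" if Q: "Q \<subseteq> p ` ?E" for Q
  proof (rule weak_topology)
    show "Q \<subseteq> topspace Y" using Q p Ttop by blast
    fix e assume e: "e \<in> C"
    obtain K where K: "finite K" "K \<subseteq> C" "\<Phi> e ` disc_boundary (d e) \<subseteq> (\<Union>e'\<in>K. cell e')"
      using closure_finite[OF e] by blast
    have "Q \<inter> \<Phi> e ` topspace (disc (d e)) \<subseteq> p ` insert e K"
    proof
      fix y assume y: "y \<in> Q \<inter> \<Phi> e ` topspace (disc (d e))"
      then obtain e1 where e1: "e1 \<in> ?E" "y = p e1" using Q by blast
      have "y \<in> cell e \<union> (\<Union>e'\<in>K. cell e')"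
        using y K(3) by (auto simp: topspace_disc_Un)
      then obtain e2 where e2: "e2 \<in> insert e K" "y \<in> cell e2" by blast
      have "e2 \<in> C" "e1 \<in> C" using e2(1) K(2) e e1(1) by auto
      then have "e2 = e1" using e2(2) p[OF e1(1)] e1(2) cell_unique[of e2 e1 y] by simp
      then show "y \<in> p ` insert e K" using e1 e2 by blast
    qed
    then have "finite (Q \<inter> \<Phi> e ` topspace (disc (d e)))"
      using K(1) finite_subset by blast
    moreover have "Q \<inter> \<Phi> e ` topspace (disc (d e)) \<subseteq> topspace Y"
      using \<open>Q \<subseteq> topspace Y\<close> by blast
    ultimately show "closedin Y (Q \<inter> \<Phi> e ` topspace (disc (d e)))"
      using closedin_Hausdorff_finite[OF hausdorff] by blast
  qed
  have "finite (p ` ?E)"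
  proof (rule ccontr)
    assume "infinite (p ` ?E)"
    moreover have "p ` ?E \<subseteq> T" using p by blast
    ultimately obtain x where x: "x \<in> Y derived_set_of (p ` ?E)"
      using compactin_imp_Bolzano_Weierstrass[OF T] by blast
    have "closedin Y (p ` ?E - {x})" by (rule clo) blast
    then have "openin Y (topspace Y - (p ` ?E - {x}))" by blast
    moreover have "x \<in> topspace Y - (p ` ?E - {x})"
      using x by (auto simp: in_derived_set_of)
    ultimately obtain y where "y \<noteq> x" "y \<in> p ` ?E" "y \<in> topspace Y - (p ` ?E - {x})"
      using x unfolding in_derived_set_of by meson
    then show False by blast
  qed
  moreover have "inj_on p ?E"
  proof (rule inj_onI)
    fix e e' assume "e \<in> ?E" "e' \<in> ?E" "p e = p e'"
    then show "e = e'" using cell_unique[of e e' "p e"] p by force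
  qed
  ultimately show ?thesis using finite_imageD by blast
qed

lemma subcomplex_UN:
  assumes "\<And>i. i \<in> I \<Longrightarrow> subcomplex (K i)"
  shows "subcomplex (\<Union>i\<in>I. K i)"
  unfolding subcomplex_def
proof (intro conjI ballI)
  show "(\<Union>i\<in>I. K i) \<subseteq> C" using assms by (auto simp: subcomplex_def)
  fix e assume "e \<in> (\<Union>i\<in>I. K i)"
  then obtain i where i: "i \<in> I" "e \<in> K i" by blast
  then have "\<Phi> e ` disc_boundary (d e) \<subseteq> cells_union {e' \<in> K i. d e' < d e}"
    using assms[of i] by (auto simp: subcomplex_def)
  also have "\<dots> \<subseteq> cells_union {e' \<in> \<Union> (K ` I). d e' < d e}"
    using i by (auto simp: cells_union_def)
  finally show "\<Phi> e ` disc_boundary (d e) \<subseteq> cells_union {e' \<in> \<Union> (K ` I). d e' < d e}" .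
qed

text \<open>
  By induction on the dimension: add to \<open>e\<close> finite subcomplexes that contain the finitely
  many lower-dimensional cells covering its boundary.
\<close>

lemma cell_in_finite_subcomplex:
  "e \<in> C \<Longrightarrow> \<exists>K. finite K \<and> subcomplex K \<and> e \<in> K"
proof (induction "d e" arbitrary: e rule: less_induct)
  case less
  obtain K0 where K0: "finite K0" "K0 \<subseteq> {e' \<in> C. d e' < d e}"
    "\<Phi> e ` disc_boundary (d e) \<subseteq> (\<Union>e'\<in>K0. cell e')"
    using closure_finite[OF less.prems] by blast
  have "\<forall>e'\<in>K0. \<exists>K. finite K \<and> subcomplex K \<and> e' \<in> K"
    using less.hyps K0(2) by blast
  then obtain K where K: "\<And>e'. e' \<in> K0 \<Longrightarrow> finite (K e') \<and> subcomplex (K e') \<and> e' \<in> K e'"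
    by metis
  let ?U = "\<Union>e'\<in>K0. K e'"
  have U: "subcomplex ?U" using K by (intro subcomplex_UN) auto
  have "subcomplex (insert e ?U)"
    unfolding subcomplex_def
  proof (intro conjI ballI)
    show "insert e ?U \<subseteq> C" using U less.prems by (auto simp: subcomplex_def)
    fix e1 assume "e1 \<in> insert e ?U"
    then consider "e1 = e" | "e1 \<in> ?U" by blast
    then show "\<Phi> e1 ` disc_boundary (d e1) \<subseteq> cells_union {e' \<in> insert e ?U. d e' < d e1}"
    proof cases
      case 1
      have "(\<Union>e'\<in>K0. cell e') \<subseteq> cells_union {e' \<in> insert e ?U. d e' < d e}"
        unfolding cells_union_def using K K0(2) by (intro UN_mono) auto
      then show ?thesis using K0(3) 1 by blast
    next
      case 2
      have "cells_union {e' \<in> ?U. d e' < d e1} \<subseteq> cells_union {e' \<in> insert e ?U. d e' < d e1}"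
        unfolding cells_union_def by (intro UN_mono) auto
      then show ?thesis using 2 U unfolding subcomplex_def by blast
    qed
  qed
  moreover have "finite (insert e ?U)" using K0(1) K by auto
  ultimately show ?case by blast
qed

lemma compact_in_finite_subcomplex:
  assumes T: "compactin Y T"
  obtains K where "finite K" "subcomplex K" "T \<subseteq> cells_union K"
proof -
  let ?E = "{e \<in> C. T \<inter> cell e \<noteq> {}}"
  have "\<forall>e\<in>?E. \<exists>K. finite K \<and> subcomplex K \<and> e \<in> K"
    using cell_in_finite_subcomplex by blast
  then obtain K where K: "\<And>e. e \<in> ?E \<Longrightarrow> finite (K e) \<and> subcomplex (K e) \<and> e \<in> K e"
    using bchoice[of ?E "\<lambda>e K. finite K \<and> subcomplex K \<and> e \<in> K"] by blast
  have "T \<subseteq> cells_union (\<Union>e\<in>?E. K e)"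
  proof
    fix y assume y: "y \<in> T"
    then have "y \<in> topspace Y" using T compactin_subset_topspace by blast
    then obtain e where "e \<in> C" "y \<in> cell e" using cells_cover by blast
    then show "y \<in> cells_union (\<Union>e\<in>?E. K e)" using K y unfolding cells_union_def by blast
  qed
  moreover have "subcomplex (\<Union>e\<in>?E. K e)" using K by (intro subcomplex_UN) blast
  moreover have "finite (\<Union>e\<in>?E. K e)"
    using K by (intro finite_UN_I finite_cells_meeting_compact[OF T]) blast
  ultimately show ?thesis using that by blast
qed

lemma cells_union_eq_closed_cells:
  assumes "subcomplex K"
  shows "cells_union K = (\<Union>e\<in>K. \<Phi> e ` topspace (disc (d e)))"
proof
  show "cells_union K \<subseteq> (\<Union>e\<in>K. \<Phi> e ` topspace (disc (d e)))"
    by (auto simp: cells_union_def topspace_disc_Un)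
  have "\<Phi> e ` topspace (disc (d e)) \<subseteq> cells_union K" if e: "e \<in> K" for e
  proof -
    have "\<Phi> e ` disc_boundary (d e) \<subseteq> cells_union {e' \<in> K. d e' < d e}"
      using assms e by (auto simp: subcomplex_def)
    also have "\<dots> \<subseteq> cells_union K" by (auto simp: cells_union_def)
    finally show ?thesis using e by (auto simp: topspace_disc_Un cells_union_def)
  qed
  then show "(\<Union>e\<in>K. \<Phi> e ` topspace (disc (d e))) \<subseteq> cells_union K" by blast
qed

lemma closedin_finite_subcomplex:
  assumes "finite K" "subcomplex K"
  shows "closedin Y (cells_union K)"
proof -
  have "closedin Y (\<Phi> e ` topspace (disc (d e)))" if "e \<in> K" for e
    using that assms(2) compactin_imp_closedin[OF hausdorff]
      compactin_cell_image[OF _ compact_disc order_refl, of e] by (auto simp: subcomplex_def)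
  then show ?thesis
    unfolding cells_union_eq_closed_cells[OF assms(2)] using assms(1) by (intro closedin_Union) auto
qed

lemma subcomplex_remove_top_cell:
  assumes K: "subcomplex K" and top: "\<And>e'. e' \<in> K \<Longrightarrow> d e' \<le> d e"
  shows "subcomplex (K - {e})"
  unfolding subcomplex_def
proof (intro conjI ballI)
  show "K - {e} \<subseteq> C" using K by (auto simp: subcomplex_def)
  fix e1 assume e1: "e1 \<in> K - {e}"
  have "{e' \<in> K. d e' < d e1} \<subseteq> {e' \<in> K - {e}. d e' < d e1}"
    using top[of e1] e1 by auto
  then have "cells_union {e' \<in> K. d e' < d e1} \<subseteq> cells_union {e' \<in> K - {e}. d e' < d e1}"
    by (auto simp: cells_union_def)
  then show "\<Phi> e1 ` disc_boundary (d e1) \<subseteq> cells_union {e' \<in> K - {e}. d e' < d e1}"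
    using K e1 unfolding subcomplex_def by blast
qed

lemma boundary_in_lower_cells:
  assumes "subcomplex K" "e \<in> K"
  shows "\<Phi> e ` disc_boundary (d e) \<subseteq> cells_union (K - {e})"
proof -
  have "\<Phi> e ` disc_boundary (d e) \<subseteq> cells_union {e' \<in> K. d e' < d e}"
    using assms by (auto simp: subcomplex_def)
  also have "\<dots> \<subseteq> cells_union (K - {e})" unfolding cells_union_def by (rule UN_mono) auto
  finally show ?thesis .
qed

lemma cell_disjoint_rest:
  assumes "subcomplex K" "e \<in> K"
  shows "cell e \<inter> cells_union (K - {e}) = {}"
  using assms cell_unique[of e] unfolding subcomplex_def cells_union_def by blast

section \<open>Deforming a finite subcomplex near a top cell\<close>

lemma cells_union_subset_topspace: "subcomplex K \<Longrightarrow> cells_union K \<subseteq> topspace Y"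
  unfolding subcomplex_def cells_union_def cells_cover by blast

lemma cells_union_remove: "e \<in> K \<Longrightarrow> cells_union K = cell e \<union> cells_union (K - {e})"
  unfolding cells_union_def by blast

lemma cell_inverse:
  assumes e: "e \<in> C"
  obtains \<psi> where "continuous_map (subtopology Y (cell e)) (disc (d e)) \<psi>"
    "\<And>z. z \<in> disc_interior (d e) \<Longrightarrow> \<psi> (\<Phi> e z) = z"
proof -
  have sub: "disc_interior (d e) \<subseteq> topspace (disc (d e))" by (auto simp: topspace_disc_Un)
  obtain \<psi> where \<psi>: "homeomorphic_maps (subtopology (disc (d e)) (disc_interior (d e)))
      (subtopology Y (cell e)) (\<Phi> e) \<psi>"
    using open_cell[OF e] homeomorphic_map_maps by blast
  show ?thesis
  proof
    show "continuous_map (subtopology Y (cell e)) (disc (d e)) \<psi>"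
      using \<psi> continuous_map_into_fulltopology unfolding homeomorphic_maps_def by blast
    show "\<psi> (\<Phi> e z) = z" if "z \<in> disc_interior (d e)" for z
      using \<psi> that sub unfolding homeomorphic_maps_def by auto
  qed
qed

text \<open>
  A homotopy of the disc that fixes the boundary acts on the image of the disc and is extended by the
  identity. On the closed union of the other cells this is clearly continuous. On the image of the disc, closed sets
  have closed preimages because \<open>id \<times> \<Phi> e\<close> maps the compact space \<open>[0, 1] \<times> D\<close> to a Hausdorff
  space and is therefore a closed map.
\<close>

lemma disc_homotopy_extends:
  assumes K: "finite K" "subcomplex K" "e \<in> K" and top: "\<And>e'. e' \<in> K \<Longrightarrow> d e' \<le> d e"
    and g: "continuous_on ({0..1::real} \<times> topspace (disc (d e))) g"
      "\<And>t z. \<lbrakk>t \<in> {0..1}; z \<in> topspace (disc (d e))\<rbrakk> \<Longrightarrow> g (t, z) \<in> topspace (disc (d e))"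
      "\<And>t z. \<lbrakk>t \<in> {0..1}; z \<in> disc_boundary (d e)\<rbrakk> \<Longrightarrow> g (t, z) = z"
  obtains G where
    "continuous_map (prod_topology (top_of_set {0..1::real}) (subtopology Y (cells_union K))) Y G"
    "\<And>t z. \<lbrakk>t \<in> {0..1}; z \<in> topspace (disc (d e))\<rbrakk> \<Longrightarrow> G (t, \<Phi> e z) = \<Phi> e (g (t, z))"
    "\<And>t y. y \<in> cells_union (K - {e}) \<Longrightarrow> G (t, y) = y"
proof -
  let ?D = "topspace (disc (d e))" and ?I = "{0..1::real}"
  let ?L = "cells_union K" and ?L' = "cells_union (K - {e})"
  let ?X = "prod_topology (top_of_set ?I) (subtopology Y ?L)"
  have eC: "e \<in> C" using K by (auto simp: subcomplex_def)
  obtain \<psi> where \<psi>: "\<And>z. z \<in> disc_interior (d e) \<Longrightarrow> \<psi> (\<Phi> e z) = z"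
    using cell_inverse[OF eC] by metis
  define G where "G = (\<lambda>(t, y). if y \<in> cell e then \<Phi> e (g (t, \<psi> y)) else y)"
  have G_rest: "G (t, y) = y" if "y \<in> ?L'" for t y
    using that cell_disjoint_rest[OF K(2,3)] by (auto simp: G_def)
  have G_cell: "G (t, \<Phi> e z) = \<Phi> e (g (t, z))" if t: "t \<in> ?I" and z: "z \<in> ?D" for t z
  proof (cases "z \<in> disc_interior (d e)")
    case True
    then show ?thesis using \<psi>[OF True] by (simp add: G_def)
  next
    case False
    then have z: "z \<in> disc_boundary (d e)" using z by (simp add: topspace_disc_Un)
    then have "\<Phi> e z \<in> ?L'" using boundary_in_lower_cells[OF K(2,3)] by blast
    then show ?thesis using G_rest g(3)[OF t z] by simp
  qed
  have LY: "?L \<subseteq> topspace Y" using cells_union_subset_topspace K by blast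
  have DL: "\<Phi> e ` ?D \<subseteq> ?L" using cells_union_eq_closed_cells[OF K(2)] K(3) by blast
  have L_eq: "?L = \<Phi> e ` ?D \<union> ?L'"
    using cells_union_remove[OF K(3)] DL by (auto simp: topspace_disc_Un)
  have clL': "closedin Y ?L'"
    using K subcomplex_remove_top_cell[OF K(2) top] by (intro closedin_finite_subcomplex) auto
  have topX: "topspace ?X = ?I \<times> ?L" using LY by auto
  have "continuous_map ?X Y G"
    unfolding continuous_map_closedin
  proof (intro conjI allI impI)
    show "G \<in> topspace ?X \<rightarrow> topspace Y"
    proof
      fix p assume "p \<in> topspace ?X"
      then obtain t y where p: "p = (t, y)" "t \<in> ?I" "y \<in> ?L" unfolding topX by blast
      then consider z where "z \<in> ?D" "y = \<Phi> e z" | "y \<in> ?L'" using L_eq by blast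
      then have "G p \<in> ?L" using p G_cell g(2) G_rest DL by cases auto
      then show "G p \<in> topspace Y" using LY by blast
    qed
    fix V assume V: "closedin Y V"
    let ?q = "\<lambda>(t, z). (t, \<Phi> e z)"
    let ?Z = "{p \<in> ?I \<times> ?D. \<Phi> e (g p) \<in> V}"
    have eq: "{p \<in> topspace ?X. G p \<in> V} = ?I \<times> (?L' \<inter> V) \<union> ?q ` ?Z"
    proof (rule set_eqI)
      fix p :: "real \<times> 'a"
      obtain t y where p: "p = (t, y)" by fastforce
      show "p \<in> {p \<in> topspace ?X. G p \<in> V} \<longleftrightarrow> p \<in> ?I \<times> (?L' \<inter> V) \<union> ?q ` ?Z"
      proof (cases "t \<in> ?I")
        case True
        have 1: "y \<in> ?L \<and> G (t, y) \<in> V \<longleftrightarrow> y \<in> ?L' \<inter> V \<or> (\<exists>z\<in>?D. y = \<Phi> e z \<and> \<Phi> e (g (t, z)) \<in> V)"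
        proof (cases "y \<in> ?L'")
          case y: True
          have "y \<in> V" if "z \<in> ?D" "y = \<Phi> e z" "\<Phi> e (g (t, z)) \<in> V" for z
            using that G_cell[OF True that(1)] G_rest[OF y, of t] by simp
          then show ?thesis using y G_rest[OF y, of t] L_eq by auto
        next
          case y: False
          have "y \<in> ?L \<longleftrightarrow> (\<exists>z\<in>?D. y = \<Phi> e z)" using y L_eq by auto
          then show ?thesis using y G_cell[OF True] by auto
        qed
        have 2: "p \<in> ?q ` ?Z \<longleftrightarrow> (\<exists>z\<in>?D. y = \<Phi> e z \<and> \<Phi> e (g (t, z)) \<in> V)"
        proof
          assume "p \<in> ?q ` ?Z"
          then show "\<exists>z\<in>?D. y = \<Phi> e z \<and> \<Phi> e (g (t, z)) \<in> V" using p by auto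
        next
          assume "\<exists>z\<in>?D. y = \<Phi> e z \<and> \<Phi> e (g (t, z)) \<in> V"
          then obtain z where "z \<in> ?D" "y = \<Phi> e z" "\<Phi> e (g (t, z)) \<in> V" by blast
          then show "p \<in> ?q ` ?Z" using p True by (intro image_eqI[where x = "(t, z)"]) auto
        qed
        have 3: "p \<in> {p \<in> topspace ?X. G p \<in> V} \<longleftrightarrow> y \<in> ?L \<and> G (t, y) \<in> V"
          unfolding mem_Collect_eq topX using True p by simp
        have 4: "p \<in> ?I \<times> (?L' \<inter> V) \<longleftrightarrow> y \<in> ?L' \<inter> V" using True p by simp
        show ?thesis unfolding Un_iff 2 3 4 1 ..
      next
        case False
        then show ?thesis unfolding mem_Collect_eq topX using p by auto
      qed
    qed
    have "continuous_map (top_of_set (?I \<times> ?D)) (disc (d e)) g"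
      by (subst disc_eq_top_of_set) (use g(1,2) in \<open>auto simp: continuous_map_in_subtopology\<close>)
    then have "continuous_map (top_of_set (?I \<times> ?D)) Y (\<Phi> e \<circ> g)"
      using characteristic_map[OF eC] continuous_map_compose by blast
    then have "closedin (top_of_set (?I \<times> ?D)) {p \<in> topspace (top_of_set (?I \<times> ?D)). (\<Phi> e \<circ> g) p \<in> V}"
      using V closedin_continuous_map_preimage by blast
    then have "closedin (top_of_set (?I \<times> ?D)) ?Z" by simp
    then have "compact ?Z"
      using closedin_compact compact_Times[OF compact_Icc compact_disc] by blast
    then have Z: "compactin (top_of_set (?I \<times> ?D)) ?Z"
      by (auto simp: compactin_subtopology)
    have TD: "top_of_set (?I \<times> ?D) = prod_topology (top_of_set ?I) (disc (d e))"
      by (subst (2) disc_eq_top_of_set) (simp add: subtopology_Times prod_topology_subtopology_eu)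
    have "continuous_map (disc (d e)) (subtopology Y ?L) (\<Phi> e)"
      using characteristic_map[OF eC] DL by (auto simp: continuous_map_in_subtopology)
    then have "continuous_map (top_of_set (?I \<times> ?D)) ?X ?q"
      unfolding TD by (intro continuous_map_prod_top[THEN iffD2]) auto
    then have "compactin ?X (?q ` ?Z)" using Z image_compactin by blast
    moreover have "Hausdorff_space ?X"
      using hausdorff by (simp add: Hausdorff_space_prod_topology Hausdorff_space_subtopology)
    ultimately have "closedin ?X (?q ` ?Z)" using compactin_imp_closedin by blast
    moreover have "closedin ?X (?I \<times> (?L' \<inter> V))"
    proof -
      have "closedin Y (?L' \<inter> V)" using clL' V by blast
      then have "closedin (subtopology Y ?L) (?L' \<inter> V)"
        using L_eq by (intro closedin_subset_topspace) auto
      then show ?thesis by (simp add: closedin_prod_Times_iff)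
    qed
    ultimately show "closedin ?X {p \<in> topspace ?X. G p \<in> V}"
      unfolding eq by blast
  qed
  then show ?thesis using that G_cell G_rest by blast
qed

text \<open>
  The homotopy divides \<open>z\<close> by \<open>max \<bar>z\<bar> (1 - t * (1 - \<eta>))\<close>. The denominator is \<open>1\<close> at \<open>t = 0\<close> and
  on the boundary sphere, and at \<open>t = 1\<close> it is \<open>\<bar>z\<bar>\<close> as soon as \<open>\<eta> \<le> \<bar>z\<bar>\<close>. It never drops below
  \<open>\<eta>\<close>, so that the formula makes sense at the centre as well.
\<close>

lemma push_to_boundary:
  assumes K: "finite K" "subcomplex K" "e \<in> K" and top: "\<And>e'. e' \<in> K \<Longrightarrow> d e' \<le> d e"
    and \<eta>: "0 < \<eta>" "\<eta> \<le> 1"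
  obtains G where
    "continuous_map (prod_topology (top_of_set {0..1::real}) (subtopology Y (cells_union K))) Y G"
    "\<And>y. y \<in> cells_union K \<Longrightarrow> G (0, y) = y"
    "\<And>t y. y \<in> cells_union (K - {e}) \<Longrightarrow> G (t, y) = y"
    "\<And>z. \<lbrakk>z \<in> topspace (disc (d e)); \<eta> \<le> L2_set z {..<d e}\<rbrakk>
        \<Longrightarrow> G (1, \<Phi> e z) \<in> cells_union (K - {e})"
proof -
  let ?D = "topspace (disc (d e))" and ?I = "{0..1::real}" and ?N = "\<lambda>z. L2_set z {..<d e}"
  define m where "m = (\<lambda>(t, z). max (?N z) (1 - t * (1 - \<eta>)))"
  define g where "g = (\<lambda>p i. snd p i * (1 / m p))"
  have m_ge: "\<eta> \<le> m (t, z)" if "t \<in> ?I" for t z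
  proof -
    have "t * (1 - \<eta>) \<le> 1 * (1 - \<eta>)" using that \<eta> by (intro mult_right_mono) auto
    then show ?thesis by (simp add: m_def)
  qed
  have Ng: "?N (g (t, z)) = ?N z / m (t, z)" if "t \<in> ?I" for t z
  proof -
    have "0 \<le> 1 / m (t, z)" using m_ge[OF that, of z] \<eta> by simp
    from L2_set_left_distrib[OF this, of z "{..<d e}"] show ?thesis by (simp add: g_def)
  qed
  have cont_m: "continuous_on (?I \<times> ?D) m"
    unfolding m_def case_prod_beta
    by (intro continuous_intros continuous_on_L2_set
        continuous_on_compose2[OF continuous_on_coordinate[of UNIV]]) auto
  have g1: "continuous_on (?I \<times> ?D) g"
    unfolding g_def
  proof (intro continuous_on_coordinatewise_then_product continuous_intros cont_m)
    fix i
    show "continuous_on (?I \<times> ?D) (\<lambda>p. snd p i)"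
      by (intro continuous_on_compose2[OF continuous_on_coordinate[of UNIV]] continuous_intros) auto
    show "\<forall>p\<in>?I \<times> ?D. m p \<noteq> 0"
    proof
      fix p assume "p \<in> ?I \<times> ?D"
      then have "\<eta> \<le> m p" using m_ge[of "fst p" "snd p"] by auto
      then show "m p \<noteq> 0" using \<eta>(1) by linarith
    qed
  qed
  have g2: "g (t, z) \<in> ?D" if t: "t \<in> ?I" and z: "z \<in> ?D" for t z
  proof -
    have "?N z \<le> m (t, z)" by (simp add: m_def)
    then have "?N z / m (t, z) \<le> 1" using m_ge[OF t, of z] \<eta>(1) by simp
    then show ?thesis using Ng[OF t] z by (simp add: topspace_disc g_def)
  qed
  have g3: "g (t, z) = z" if t: "t \<in> ?I" and z: "z \<in> disc_boundary (d e)" for t z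
  proof -
    have "0 \<le> t * (1 - \<eta>)" using t \<eta> by simp
    then have "m (t, z) = 1" using z by (simp add: m_def disc_boundary_eq)
    then show ?thesis by (simp add: g_def)
  qed
  obtain G where G: "continuous_map (prod_topology (top_of_set ?I) (subtopology Y (cells_union K))) Y G"
    "\<And>t z. \<lbrakk>t \<in> ?I; z \<in> ?D\<rbrakk> \<Longrightarrow> G (t, \<Phi> e z) = \<Phi> e (g (t, z))"
    "\<And>t y. y \<in> cells_union (K - {e}) \<Longrightarrow> G (t, y) = y"
    using disc_homotopy_extends[OF K top g1 g2 g3] by blast
  have G0: "G (0, y) = y" if y: "y \<in> cells_union K" for y
  proof (cases "y \<in> cells_union (K - {e})")
    case False
    then obtain z where z: "z \<in> ?D" "y = \<Phi> e z"
      using y cells_union_remove[OF K(3)] by (auto simp: topspace_disc_Un)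
    have "m (0, z) = 1" using z(1) by (simp add: m_def topspace_disc)
    then show ?thesis using z G(2)[of 0 z] by (simp add: g_def)
  qed (rule G(3))
  have "G (1, \<Phi> e z) \<in> cells_union (K - {e})" if z: "z \<in> ?D" "\<eta> \<le> ?N z" for z
  proof -
    have "m (1, z) = ?N z" using z(2) by (simp add: m_def)
    then have "?N (g (1, z)) = 1" using Ng[of 1 z] z(2) \<eta>(1) by simp
    then have "g (1, z) \<in> disc_boundary (d e)"
      using g2[of 1 z] z(1) by (auto simp: disc_boundary_eq topspace_disc)
    then show ?thesis using G(2)[of 1 z] z(1) boundary_in_lower_cells[OF K(2,3)] by auto
  qed
  with G G0 that show ?thesis by blast
qed

text \<open>
  Let \<open>u\<close> be \<open>f\<close> in the coordinates of the cell, on the compact set \<open>A\<close> where \<open>\<bar>u\<bar> \<le> 3/4\<close>. Approximate \<open>u\<close>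
  by a Lipschitz map \<open>w\<close> and subtract a small point \<open>c\<close> that \<open>w\<close> misses; the result \<open>w - c\<close> never
  vanishes and differs from \<open>u\<close> by at most \<open>1/4\<close>. The homotopy goes linearly from \<open>u\<close> towards \<open>w - c\<close>,
  slowed down by a cut-off \<open>lam\<close> that is \<open>1\<close> for \<open>\<bar>u\<bar> \<le> 1/2\<close> and \<open>0\<close> for \<open>\<bar>u\<bar> = 3/4\<close>. At its end the map
  avoids \<open>0\<close>: where \<open>\<bar>u\<bar> \<le> 1/2\<close> it equals \<open>w - c\<close>, and elsewhere it has moved by at most \<open>1/4\<close>.
  Compactness of \<open>A\<close> turns this into the lower bound \<open>\<eta>\<close>.
\<close>

lemma homotope_off_center:
  assumes K: "finite K" "subcomplex K" "e \<in> K" and top: "\<And>e'. e' \<in> K \<Longrightarrow> d e' \<le> d e"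
    and n: "n < d e"
    and f: "continuous_map (nsphere n) Y f" "f ` topspace (nsphere n) \<subseteq> cells_union K"
  obtains H \<eta> where
    "continuous_map (prod_topology (top_of_set {0..1::real}) (nsphere n)) Y H"
    "\<And>x. x \<in> topspace (nsphere n) \<Longrightarrow> H (0, x) = f x"
    "\<And>t x. f x \<in> cells_union (K - {e}) \<Longrightarrow> H (t, x) = f x"
    "0 < \<eta>" "\<eta> \<le> 1"
    "\<And>x. x \<in> topspace (nsphere n) \<Longrightarrow> H (1, x) \<in> cells_union (K - {e}) \<union>
       \<Phi> e ` {z \<in> topspace (disc (d e)). \<eta> \<le> L2_set z {..<d e}}"
proof -
  let ?k = "d e"
  let ?S = "topspace (nsphere n)" and ?D = "topspace (disc ?k)" and ?I = "{0..1::real}"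
  let ?N = "\<lambda>z. L2_set z {..<?k}" and ?L' = "cells_union (K - {e})"
  have eC: "e \<in> C" using K by (auto simp: subcomplex_def)
  obtain \<psi> where \<psi>: "continuous_map (subtopology Y (cell e)) (disc ?k) \<psi>"
    "\<And>z. z \<in> disc_interior ?k \<Longrightarrow> \<psi> (\<Phi> e z) = z"
    using cell_inverse[OF eC] by metis
  define u where "u = \<psi> \<circ> f"
  define P where "P = ?D \<inter> {z. ?N z \<le> 3 / 4}"
  define R where "R = ?D \<inter> {z. 3 / 4 \<le> ?N z}"
  have contN: "continuous_on UNIV ?N"
    by (intro continuous_on_L2_set continuous_on_coordinate)
  have "compact P" "compact R"
    unfolding P_def R_def
    by (intro compact_Int_closed compact_disc closed_Collect_le contN continuous_on_const)+
  then have "compactin Y (\<Phi> e ` P)" "compactin Y (\<Phi> e ` R)"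
    using compactin_cell_image[OF eC] by (auto simp: P_def R_def)
  then have clP: "closedin Y (\<Phi> e ` P)" and clR: "closedin Y (\<Phi> e ` R)"
    using compactin_imp_closedin[OF hausdorff] by auto
  have clL': "closedin Y ?L'"
    using K subcomplex_remove_top_cell[OF K(2) top] by (intro closedin_finite_subcomplex) auto
  have PI: "P \<subseteq> disc_interior ?k" by (auto simp: P_def topspace_disc disc_interior_eq)
  define A where "A = {x \<in> ?S. f x \<in> \<Phi> e ` P}"
  define B where "B = {x \<in> ?S. f x \<in> ?L' \<union> \<Phi> e ` R}"
  have clA: "closedin (nsphere n) A" and clB: "closedin (nsphere n) B"
    unfolding A_def B_def
    by (intro closedin_continuous_map_preimage[OF f(1)] clP clR clL' closedin_Un)+
  have AS: "A \<subseteq> ?S" and BS: "B \<subseteq> ?S" by (auto simp: A_def B_def)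
  have AB: "A \<union> B = ?S"
  proof -
    have "x \<in> A \<union> B" if x: "x \<in> ?S" for x
    proof -
      have "f x \<in> cell e \<union> ?L'" using f(2) x cells_union_remove[OF K(3)] by blast
      moreover have "cell e \<subseteq> \<Phi> e ` P \<union> \<Phi> e ` R"
      proof -
        have "disc_interior ?k \<subseteq> P \<union> R" by (auto simp: P_def R_def topspace_disc_Un)
        then show ?thesis by blast
      qed
      ultimately show ?thesis using x unfolding A_def B_def by blast
    qed
    then show ?thesis using AS BS by blast
  qed
  have cA: "compact A"
    using clA closedin_compact[OF compact_nsphere[of n]] nsphere_eq_top_of_set[of n] by metis
  have u_eq: "u x \<in> P \<and> \<Phi> e (u x) = f x" if x: "x \<in> A" for x
  proof -
    obtain z where z: "z \<in> P" "f x = \<Phi> e z" using x unfolding A_def by blast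
    then have "u x = z" using \<psi>(2)[of z] PI by (auto simp: u_def)
    then show ?thesis using z by simp
  qed
  have "continuous_on A u"
  proof -
    have "f ` A \<subseteq> cell e" using PI by (auto simp: A_def)
    then have "continuous_map (subtopology (nsphere n) A) (subtopology Y (cell e)) f"
      using f(1) AS by (auto simp: continuous_map_in_subtopology continuous_map_from_subtopology)
    then have "continuous_map (subtopology (nsphere n) A) (disc ?k) u"
      unfolding u_def using \<psi>(1) continuous_map_compose by blast
    moreover have "subtopology (nsphere n) A = top_of_set A"
      using AS nsphere_eq_top_of_set[of n] by (metis inf.absorb2 subtopology_subtopology)
    ultimately have "continuous_map (top_of_set A) (top_of_set ?D) u"
      using disc_eq_top_of_set by metis
    then show ?thesis using continuous_map_into_fulltopology by fastforce
  qed
  then have cu: "continuous_on A (\<lambda>x. u x i)" for i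
    by (intro continuous_on_compose2[OF continuous_on_coordinate[of UNIV]]) auto
  \<comment> \<open>Each of the \<open>k\<close> coordinates moves by at most \<open>2 * \<epsilon>\<close>, half of it due to \<open>w\<close> and half to \<open>c\<close>.
      Together this is at most \<open>1/4\<close>.\<close>
  define \<epsilon> where "\<epsilon> = 1 / (8 * real ?k)"
  have \<epsilon>: "\<epsilon> > 0" using n by (simp add: \<epsilon>_def)
  have "\<exists>w. (\<exists>L. L-lipschitz_on UNIV w) \<and> (\<forall>x\<in>A. \<bar>w x - u x i\<bar> \<le> \<epsilon>)" for i
    using lipschitz_approximation[OF cA cu \<epsilon>] by blast
  then obtain w where w: "\<And>i. \<exists>L. L-lipschitz_on UNIV (w i)"
    "\<And>i x. x \<in> A \<Longrightarrow> \<bar>w i x - u x i\<bar> \<le> \<epsilon>"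
    by metis
  have "\<exists>L. L-lipschitz_on ?S (w i)" for i
    using w(1)[of i] lipschitz_on_subset by blast
  then obtain c where c: "\<And>i. i < ?k \<Longrightarrow> \<bar>c i\<bar> \<le> \<epsilon>"
    "\<And>x. x \<in> ?S \<Longrightarrow> \<exists>i<?k. w i x \<noteq> c i"
    using lipschitz_sphere_image_misses[OF n \<epsilon>, of w] by blast
  define \<delta> where "\<delta> = (\<lambda>x i. w i x - c i - u x i)"
  have N\<delta>: "?N (\<delta> x) \<le> 1 / 4" if x: "x \<in> A" for x
  proof -
    have "?N (\<delta> x) \<le> (\<Sum>i<?k. \<bar>\<delta> x i\<bar>)" by (rule L2_set_le_sum_abs)
    also have "\<dots> \<le> (\<Sum>i<?k. 2 * \<epsilon>)"
    proof (rule sum_mono)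
      fix i assume "i \<in> {..<?k}"
      then show "\<bar>\<delta> x i\<bar> \<le> 2 * \<epsilon>" using w(2)[OF x, of i] c(1)[of i] by (auto simp: \<delta>_def)
    qed
    also have "\<dots> = 1 / 4" using n by (simp add: \<epsilon>_def)
    finally show ?thesis .
  qed
  define lam where "lam = (\<lambda>x. max 0 (min 1 (3 - 4 * ?N (u x))))"
  have lam: "0 \<le> lam x" "lam x \<le> 1" for x by (auto simp: lam_def)
  define v where "v = (\<lambda>p i. if i < ?k then u (snd p) i + fst p * lam (snd p) * \<delta> (snd p) i else 0)"
  have Ns: "?N (\<lambda>i. s * \<delta> x i) \<le> 1 / 4" if "x \<in> A" "0 \<le> s" "s \<le> 1" for x s
  proof -
    have "?N (\<lambda>i. s * \<delta> x i) = s * ?N (\<delta> x)"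
      using L2_set_right_distrib[OF that(2), of "\<delta> x" "{..<?k}"] by simp
    also have "\<dots> \<le> 1 * (1 / 4)" using that N\<delta>[OF that(1)] by (intro mult_mono) auto
    finally show ?thesis by simp
  qed
  have Nv: "?N (v (t, x)) = ?N (\<lambda>i. u x i + (t * lam x) * \<delta> x i)" for t x
    by (rule L2_set_cong) (auto simp: v_def)
  have tl: "0 \<le> t * lam x \<and> t * lam x \<le> 1" if "t \<in> ?I" for t x
    using that lam[of x] by (auto intro: mult_le_one)
  have vD: "v (t, x) \<in> ?D" if t: "t \<in> ?I" and x: "x \<in> A" for t x
  proof -
    have "?N (v (t, x)) \<le> ?N (u x) + ?N (\<lambda>i. (t * lam x) * \<delta> x i)"
      unfolding Nv by (rule L2_set_triangle_ineq)
    also have "\<dots> \<le> 3 / 4 + 1 / 4"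
      using u_eq[OF x] Ns[OF x] tl[OF t] by (intro add_mono) (auto simp: P_def)
    finally show ?thesis by (simp add: topspace_disc v_def)
  qed
  have v1: "?N (v (1, x)) \<noteq> 0" if x: "x \<in> A" for x
  proof (cases "?N (u x) \<le> 1 / 2")
    case True
    then have "lam x = 1" by (simp add: lam_def)
    obtain i where i: "i < ?k" "w i x \<noteq> c i" using c(2) x AS by blast
    then have "v (1, x) i \<noteq> 0" using \<open>lam x = 1\<close> by (simp add: v_def \<delta>_def)
    then show ?thesis using i(1) by (auto simp: L2_set_eq_0_iff)
  next
    case False
    have "?N (u x) = ?N (\<lambda>i. v (1, x) i + - (lam x * \<delta> x i))"
      by (rule L2_set_cong) (auto simp: v_def)
    also have "\<dots> \<le> ?N (v (1, x)) + ?N (\<lambda>i. - (lam x * \<delta> x i))"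
      by (rule L2_set_triangle_ineq)
    also have "?N (\<lambda>i. - (lam x * \<delta> x i)) = ?N (\<lambda>i. lam x * \<delta> x i)"
      by (simp add: L2_set_def)
    finally show ?thesis using Ns[OF x lam[of x]] False by linarith
  qed
  have cN: "continuous_on A (\<lambda>x. ?N (u x))" by (intro continuous_on_L2_set cu)
  have cw: "continuous_on UNIV (w i)" for i
    using w(1)[of i] lipschitz_on_continuous_on by blast
  have cv: "continuous_on (?I \<times> A) v"
  proof (rule continuous_on_coordinatewise_then_product)
    fix i
    have cs: "continuous_on (?I \<times> A) (\<lambda>p. h (snd p))" if "continuous_on A h" for h :: "_ \<Rightarrow> real"
      by (rule continuous_on_compose2[OF that]) (auto intro: continuous_intros)
    have "continuous_on A lam" unfolding lam_def by (intro continuous_intros cN)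
    moreover have "continuous_on A (\<lambda>x. \<delta> x i)"
      unfolding \<delta>_def by (intro continuous_intros cu continuous_on_subset[OF cw]) auto
    ultimately have "continuous_on (?I \<times> A) (\<lambda>p. u (snd p) i + fst p * lam (snd p) * \<delta> (snd p) i)"
      by (intro continuous_intros cs[OF cu] cs)
    then show "continuous_on (?I \<times> A) (\<lambda>p. v p i)"
      by (cases "i < ?k") (simp_all add: v_def)
  qed
  define H where "H = (\<lambda>(t, x). if x \<in> A then \<Phi> e (v (t, x)) else f x)"
  have v_id: "v (t, x) = u x" if x: "x \<in> A" and 0: "t * lam x = 0" for t x
    using u_eq[OF x] 0 by (auto simp: v_def P_def topspace_disc)
  have H_f: "H (t, x) = f x" if x: "x \<in> A \<Longrightarrow> t * lam x = 0" for t x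
    using v_id[OF _ x] u_eq by (auto simp: H_def)
  have AL': "f x \<notin> ?L'" if "x \<in> A" for x
    using that PI cell_disjoint_rest[OF K(2,3)] by (auto simp: A_def)
  \<comment> \<open>On the overlap of the two closed pieces \<open>\<bar>u\<bar> = 3/4\<close>, so the two formulas for the homotopy agree.\<close>
  have lamB: "lam x = 0" if xA: "x \<in> A" and xB: "x \<in> B" for x
  proof -
    obtain z where z: "z \<in> R" "f x = \<Phi> e z" using xB AL'[OF xA] by (auto simp: B_def)
    have "z \<in> disc_interior ?k"
    proof (rule ccontr)
      assume "z \<notin> disc_interior ?k"
      then have "z \<in> disc_boundary ?k" using z(1) by (auto simp: R_def topspace_disc_Un)
      then show False using boundary_in_lower_cells[OF K(2,3)] z(2) AL'[OF xA] by auto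
    qed
    then have "u x = z" using z \<psi>(2) by (simp add: u_def)
    then show ?thesis using z(1) by (simp add: lam_def R_def)
  qed
  let ?X = "top_of_set (?I \<times> ?S)"
  have X: "prod_topology (top_of_set ?I) (nsphere n) = ?X"
    by (subst nsphere_eq_top_of_set) (simp add: subtopology_Times prod_topology_subtopology_eu)
  have "continuous_map ?X Y H"
  proof (rule pasting_lemma_closed[where I = UNIV and T = "\<lambda>b. ?I \<times> (if b then A else B)"
        and f = "\<lambda>b. if b then \<Phi> e \<circ> v else f \<circ> snd"])
    show "closedin ?X (?I \<times> (if b then A else B))" for b
      unfolding X[symmetric] using clA clB by (simp add: closedin_prod_Times_iff)
    show "continuous_map (subtopology ?X (?I \<times> (if b then A else B))) Y
        (if b then \<Phi> e \<circ> v else f \<circ> snd)" for b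
    proof (cases b)
      case True
      have "continuous_map (top_of_set (?I \<times> A)) (disc ?k) v"
        by (subst disc_eq_top_of_set) (use cv vD in \<open>auto simp: continuous_map_in_subtopology\<close>)
      then have "continuous_map (top_of_set (?I \<times> A)) Y (\<Phi> e \<circ> v)"
        using characteristic_map[OF eC] continuous_map_compose by blast
      moreover have "subtopology ?X (?I \<times> A) = top_of_set (?I \<times> A)"
        using AS by (simp add: subtopology_subtopology Int_absorb1 Sigma_mono)
      ultimately show ?thesis using True by simp
    next
      case False
      have "continuous_map ?X (nsphere n) snd"
        unfolding X[symmetric] by (rule continuous_map_snd)
      then have "continuous_map ?X Y (f \<circ> snd)"
        using f(1) continuous_map_compose by blast
      then show ?thesis using False continuous_map_from_subtopology by auto
    qed
    show "(if i then \<Phi> e \<circ> v else f \<circ> snd) p = (if j then \<Phi> e \<circ> v else f \<circ> snd) p"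
      if "p \<in> topspace ?X \<inter> (?I \<times> (if i then A else B)) \<inter> (?I \<times> (if j then A else B))" for i j p
    proof -
      have "\<Phi> e (v (t, x)) = f x" if "x \<in> A" "x \<in> B" for t x
        using v_id[OF that(1)] lamB[OF that] u_eq[OF that(1)] by simp
      then show ?thesis using that by (cases i; cases j) auto
    qed
    show "\<exists>j. j \<in> UNIV \<and> p \<in> ?I \<times> (if j then A else B) \<and> H p = (if j then \<Phi> e \<circ> v else f \<circ> snd) p"
      if pX: "p \<in> topspace ?X" for p
    proof -
      obtain t x where p: "p = (t, x)" "t \<in> ?I" "x \<in> ?S" using pX by auto
      show ?thesis
      proof (cases "x \<in> A")
        case True
        then show ?thesis using p by (intro exI[of _ True]) (simp add: H_def)
      next
        case False
        then have "x \<in> B" using AB p by blast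
        then show ?thesis using p False by (intro exI[of _ False]) (simp add: H_def)
      qed
    qed
  qed auto
  then have H1: "continuous_map (prod_topology (top_of_set ?I) (nsphere n)) Y H"
    unfolding X .
  have "\<exists>\<eta>>0. \<forall>x\<in>A. \<eta> \<le> ?N (v (1, x))"
  proof (cases "A = {}")
    case True
    then show ?thesis using zero_less_one by blast
  next
    case False
    have "continuous_on A (\<lambda>x. v (1, x))"
      by (rule continuous_on_compose2[OF cv]) (auto intro: continuous_intros)
    then have "continuous_on A (\<lambda>x. ?N (v (1, x)))"
      by (intro continuous_on_compose2[OF contN]) auto
    then obtain x0 where x0: "x0 \<in> A" "\<And>x. x \<in> A \<Longrightarrow> ?N (v (1, x0)) \<le> ?N (v (1, x))"
      using continuous_attains_inf[OF cA False] by blast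
    moreover have "0 < ?N (v (1, x0))" using v1[OF x0(1)] L2_set_nonneg[of "v (1, x0)"] by (simp add: less_le)
    ultimately show ?thesis by blast
  qed
  then obtain \<eta>0 where \<eta>0: "\<eta>0 > 0" "\<And>x. x \<in> A \<Longrightarrow> \<eta>0 \<le> ?N (v (1, x))" by blast
  \<comment> \<open>The bound \<open>3/4\<close> serves the points outside \<open>A\<close>, where the map has not moved.\<close>
  define \<eta> where "\<eta> = min \<eta>0 (3 / 4)"
  show ?thesis
  proof (rule that[OF H1])
    show "H (0, x) = f x" for x by (rule H_f) simp
    show "H (t, x) = f x" if "f x \<in> ?L'" for t x
      using AL' that by (intro H_f) blast
    show "0 < \<eta>" "\<eta> \<le> 1" using \<eta>0(1) by (auto simp: \<eta>_def)
    show "H (1, x) \<in> ?L' \<union> \<Phi> e ` {z \<in> ?D. \<eta> \<le> ?N z}" if x: "x \<in> ?S" for x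
    proof (cases "x \<in> A")
      case True
      then have "v (1, x) \<in> {z \<in> ?D. \<eta> \<le> ?N z}"
        using vD[of 1 x] \<eta>0(2)[OF True] by (simp add: \<eta>_def)
      then show ?thesis using True by (auto simp: H_def)
    next
      case False
      then have "f x \<in> ?L' \<union> \<Phi> e ` R" using x AB by (auto simp: B_def)
      moreover have "R \<subseteq> {z \<in> ?D. \<eta> \<le> ?N z}" by (auto simp: R_def \<eta>_def)
      ultimately show ?thesis using False by (auto simp: H_def)
    qed
  qed
qed


section \<open>Cellular approximation of maps from spheres\<close>

text \<open>
  Once the image avoids a ball around the centre of \<open>e\<close>, radial projection of the subcomplex carries
  it into the remaining cells.
\<close>

lemma homotope_off_top_cell:
  assumes K: "finite K" "subcomplex K" "e \<in> K" and top: "\<And>e'. e' \<in> K \<Longrightarrow> d e' \<le> d e"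
    and n: "n < d e"
    and f: "continuous_map (nsphere n) Y f" "f ` topspace (nsphere n) \<subseteq> cells_union K"
    and base: "f sphere_base \<in> cells_union (K - {e})"
  obtains g where "pointed_homotopic (nsphere n) sphere_base Y (f sphere_base) f g"
    "g ` topspace (nsphere n) \<subseteq> cells_union (K - {e})"
proof -
  let ?S = "topspace (nsphere n)" and ?L = "cells_union K" and ?L' = "cells_union (K - {e})"
  let ?D = "topspace (disc (d e))" and ?XS = "prod_topology (top_of_set {0..1::real}) (nsphere n)"
  obtain H \<eta> where H: "continuous_map ?XS Y H"
    "\<And>x. x \<in> ?S \<Longrightarrow> H (0, x) = f x"
    "\<And>t x. f x \<in> ?L' \<Longrightarrow> H (t, x) = f x"
    and \<eta>: "0 < \<eta>" "\<eta> \<le> 1"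
    and H1: "\<And>x. x \<in> ?S \<Longrightarrow> H (1, x) \<in> ?L' \<union> \<Phi> e ` {z \<in> ?D. \<eta> \<le> L2_set z {..<d e}}"
    by (rule homotope_off_center[OF K top n f]) (assumption, rule that)
  obtain G where G:
    "continuous_map (prod_topology (top_of_set {0..1::real}) (subtopology Y ?L)) Y G"
    "\<And>y. y \<in> ?L \<Longrightarrow> G (0, y) = y"
    "\<And>t y. y \<in> ?L' \<Longrightarrow> G (t, y) = y"
    "\<And>z. \<lbrakk>z \<in> ?D; \<eta> \<le> L2_set z {..<d e}\<rbrakk> \<Longrightarrow> G (1, \<Phi> e z) \<in> ?L'"
    by (rule push_to_boundary[OF K top \<eta>]) (assumption, rule that)
  define h where "h = (\<lambda>x. H (1, x))"
  define g where "g = (\<lambda>x. G (1, h x))"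
  have DL: "\<Phi> e ` ?D \<subseteq> ?L" using cells_union_eq_closed_cells[OF K(2)] K(3) by blast
  have L'L: "?L' \<subseteq> ?L" using cells_union_remove[OF K(3)] by blast
  have hL: "h x \<in> ?L" if "x \<in> ?S" for x
    using H1[OF that] DL L'L unfolding h_def by blast
  have h: "continuous_map (nsphere n) (subtopology Y ?L) h"
  proof -
    have "continuous_map (nsphere n) ?XS (\<lambda>x. (1, x))"
      by (simp add: continuous_map_pairwise o_def)
    then have "continuous_map (nsphere n) Y (H \<circ> (\<lambda>x. (1, x)))"
      using H(1) continuous_map_compose by blast
    then show ?thesis using hL by (auto simp: continuous_map_in_subtopology h_def o_def)
  qed
  have "pointed_homotopic (nsphere n) sphere_base Y (f sphere_base) f h"
    by (rule pointed_homotopic_nsphereI[OF H(1,2)]) (simp_all add: h_def H(3)[OF base])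
  moreover have "pointed_homotopic (nsphere n) sphere_base Y (f sphere_base) h g"
  proof (rule pointed_homotopic_nsphereI)
    have "continuous_map ?XS (prod_topology (top_of_set {0..1::real}) (subtopology Y ?L))
        (\<lambda>(t, x). (t, h x))"
      by (rule continuous_map_prod_top[THEN iffD2]) (use h in auto)
    then show "continuous_map ?XS Y (G \<circ> (\<lambda>(t, x). (t, h x)))"
      using G(1) continuous_map_compose by blast
    show "(G \<circ> (\<lambda>(t, x). (t, h x))) (0, x) = h x" if "x \<in> ?S" for x
      using G(2)[OF hL[OF that]] by simp
    show "(G \<circ> (\<lambda>(t, x). (t, h x))) (1, x) = g x" for x by (simp add: g_def)
    show "(G \<circ> (\<lambda>(t, x). (t, h x))) (t, sphere_base) = f sphere_base" for t
      using G(3) H(3)[OF base] base by (simp add: h_def)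
  qed
  ultimately have "pointed_homotopic (nsphere n) sphere_base Y (f sphere_base) f g"
    unfolding pointed_homotopic_def by (rule homotopic_with_trans)
  moreover have "g x \<in> ?L'" if x: "x \<in> ?S" for x
    using H1[OF x] G(3,4) unfolding g_def h_def by auto
  ultimately show ?thesis using that by blast
qed

text \<open>
  Induction on the number of cells of dimension above \<open>m\<close>. The cell removed must have the largest
  dimension in \<open>K\<close>, since otherwise the rest need not be a subcomplex. The base point stays in the rest
  because \<open>y0\<close> lies in a cell of dimension at most \<open>m\<close>.
\<close>

lemma homotope_subcomplex_to_skeleton:
  assumes "finite K" "subcomplex K" and nm: "n \<le> m"
    and "continuous_map (nsphere n) Y f" "f ` topspace (nsphere n) \<subseteq> cells_union K"
    and base: "f sphere_base = y0" "y0 \<in> cw_skeleton C d \<Phi> m"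
  shows "\<exists>g. pointed_homotopic (nsphere n) sphere_base Y y0 f g \<and>
    g ` topspace (nsphere n) \<subseteq> cw_skeleton C d \<Phi> m"
  using assms(1,2,4,5) base(1)
proof (induction "card {e \<in> K. m < d e}" arbitrary: K f rule: less_induct)
  case less
  note K = less.prems(1,2) and f = less.prems(3,4) and fb = less.prems(5)
  let ?E = "{e \<in> K. m < d e}"
  have sb: "sphere_base \<in> topspace (nsphere n)"
    unfolding sphere_base_def by (rule in_topspace_nsphere)
  show ?case
  proof (cases "?E = {}")
    case True
    have "K \<subseteq> {e \<in> C. d e \<le> m}" using True K(2) by (auto simp: subcomplex_def not_less)
    then have "cells_union K \<subseteq> cw_skeleton C d \<Phi> m"
      unfolding cells_union_def cw_skeleton_def by (rule UN_mono) auto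
    moreover have "pointed_homotopic (nsphere n) sphere_base Y y0 f f"
      using f(1) fb by (simp add: pointed_homotopic_def)
    ultimately show ?thesis using f(2) by blast
  next
    case False
    have "finite ?E" using K(1) by simp
    then have "Max (d ` ?E) \<in> d ` ?E" using False by (intro Max_in) auto
    then obtain e where e: "e \<in> ?E" "d e = Max (d ` ?E)" by auto
    have top: "d e' \<le> d e" if "e' \<in> K" for e'
    proof (cases "m < d e'")
      case True
      then show ?thesis using that e(2) \<open>finite ?E\<close> by simp
    qed (use e(1) in auto)
    have eK: "e \<in> K" and ne: "n < d e" using e(1) nm by auto
    have "y0 \<notin> cell e"
    proof
      assume "y0 \<in> cell e"
      moreover obtain e' where "e' \<in> C" "d e' \<le> m" "y0 \<in> cell e'"
        using base(2) by (auto simp: cw_skeleton_def)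
      moreover have "e \<in> C" using eK K(2) by (auto simp: subcomplex_def)
      ultimately have "e' = e" using cell_unique by metis
      then show False using \<open>d e' \<le> m\<close> e(1) by simp
    qed
    moreover have "y0 \<in> cells_union K" using f(2) sb fb by blast
    ultimately have y0: "f sphere_base \<in> cells_union (K - {e})"
      using cells_union_remove[OF eK] fb by blast
    obtain g where g: "pointed_homotopic (nsphere n) sphere_base Y y0 f g"
      "g ` topspace (nsphere n) \<subseteq> cells_union (K - {e})"
      using homotope_off_top_cell[OF K eK top ne f y0] fb by metis
    have "{e' \<in> K - {e}. m < d e'} \<subset> ?E" using e(1) by blast
    then have "card {e' \<in> K - {e}. m < d e'} < card ?E"
      using \<open>finite ?E\<close> psubset_card_mono by blast
    moreover have "continuous_map (nsphere n) Y g" "g sphere_base = y0"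
      using g(1) unfolding pointed_homotopic_def
      by (auto dest: homotopic_with_imp_continuous_maps homotopic_with_imp_property)
    ultimately obtain g' where g': "pointed_homotopic (nsphere n) sphere_base Y y0 g g'"
      "g' ` topspace (nsphere n) \<subseteq> cw_skeleton C d \<Phi> m"
      using less.hyps[of "K - {e}" g] K subcomplex_remove_top_cell[OF K(2) top] g(2) by blast
    then show ?thesis
      using g(1) homotopic_with_trans unfolding pointed_homotopic_def by blast
  qed
qed

theorem cellular_approximation:
  assumes f: "pointed_map (nsphere n) sphere_base Y y0 f"
    and "n \<le> m" "y0 \<in> cw_skeleton C d \<Phi> m"
  shows "\<exists>g. pointed_homotopic (nsphere n) sphere_base Y y0 f g \<and>
    g ` topspace (nsphere n) \<subseteq> cw_skeleton C d \<Phi> m"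
proof -
  have fc: "continuous_map (nsphere n) Y f" "f sphere_base = y0"
    using f by (auto simp: pointed_map_def)
  have "compactin (nsphere n) (topspace (nsphere n))"
    by (subst nsphere_eq_top_of_set) (simp add: compactin_subtopology compact_nsphere)
  then have "compactin Y (f ` topspace (nsphere n))"
    using image_compactin fc(1) by blast
  then obtain K where "finite K" "subcomplex K" "f ` topspace (nsphere n) \<subseteq> cells_union K"
    using compact_in_finite_subcomplex by blast
  then show ?thesis using homotope_subcomplex_to_skeleton assms(2,3) fc by blast
qed

end

section \<open>Relaxed evaluation subgroups\<close>

text \<open>
  The graph of a representative with values in \<open>Z\<close> is a section, and the second projection is the
  required map \<open>F\<close>.
\<close>

lemma relaxed_evaluation_full:
  assumes Z: "Z \<subseteq> topspace Y" "y0 \<in> Z"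
    and compress: "\<And>f. pointed_map (nsphere n) sphere_base Y y0 f \<Longrightarrow>
      \<exists>g. pointed_homotopic (nsphere n) sphere_base Y y0 f g \<and> g ` topspace (nsphere n) \<subseteq> Z"
  shows "relaxed_evaluation n Y y0 (subtopology Y Z) y0 id = homotopy_group n Y y0"
proof
  let ?S = "nsphere n" and ?X = "subtopology Y Z"
  show "relaxed_evaluation n Y y0 ?X y0 id \<subseteq> homotopy_group n Y y0"
    by (auto simp: relaxed_evaluation_def)
  show "homotopy_group n Y y0 \<subseteq> relaxed_evaluation n Y y0 ?X y0 id"
  proof
    fix a assume a: "a \<in> homotopy_group n Y y0"
    then obtain f where f: "pointed_map ?S sphere_base Y y0 f"
      and a_eq: "a = {(f, g). pointed_homotopic ?S sphere_base Y y0 f g} `` {f}"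
      unfolding homotopy_group_def by (auto elim!: quotientE)
    obtain g where g: "pointed_homotopic ?S sphere_base Y y0 f g" "g ` topspace ?S \<subseteq> Z"
      using compress[OF f] by blast
    have gc: "continuous_map ?S Y g" "g sphere_base = y0"
      using g(1) unfolding pointed_homotopic_def
      by (auto dest: homotopic_with_imp_continuous_maps homotopic_with_imp_property)
    have "continuous_map ?S ?X g" using gc g(2) by (auto simp: continuous_map_in_subtopology)
    then have "continuous_map ?S (prod_topology ?S ?X) (\<lambda>b. (b, g b))"
      by (intro continuous_map_pairedI) auto
    then have "is_section ?S sphere_base ?X y0 (\<lambda>b. (b, g b))"
      using gc(2) by (simp add: is_section_def pointed_map_def pointed_homotopic_def o_def id_def)
    moreover have id: "continuous_map ?X Y id"
      by (simp add: continuous_map_from_subtopology)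
    then have "continuous_map (prod_topology ?S ?X) Y snd"
      using continuous_map_compose[OF continuous_map_snd id] by (simp add: o_def)
    then have "pointed_map (prod_topology ?S ?X) (sphere_base, y0) Y y0 snd"
      by (simp add: pointed_map_def)
    moreover have "snd \<circ> (\<lambda>b. (b, g b)) \<in> a" using g(1) by (simp add: a_eq o_def)
    moreover have "pointed_homotopic ?X y0 Y y0 (snd \<circ> (\<lambda>x. (sphere_base, x))) id"
      using id by (simp add: pointed_homotopic_def o_def id_def)
    ultimately show "a \<in> relaxed_evaluation n Y y0 ?X y0 id"
      using a unfolding relaxed_evaluation_def by blast
  qed
qed

theorem proposition1p2:
  fixes Y :: "'a topology"
    and C :: "'i set"
    and d :: "'i \<Rightarrow> nat"
    and \<Phi> :: "'i \<Rightarrow> (nat \<Rightarrow> real) \<Rightarrow> 'a"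
    and y0 :: 'a
  assumes "cw_complex Y C d \<Phi>"
    and "connected_space Y"
    and "y0 \<in> topspace Y"
  shows "(\<forall>n m. 1 \<le> n \<longrightarrow> n \<le> m \<longrightarrow> y0 \<in> cw_skeleton C d \<Phi> m \<longrightarrow>
            relaxed_evaluation n Y y0 (subtopology Y (cw_skeleton C d \<Phi> m)) y0 id
              = homotopy_group n Y y0) \<and>
         (\<forall>n\<ge>1. relaxed_evaluation n Y y0 Y y0 id = homotopy_group n Y y0)"
proof (intro conjI allI impI)
  interpret cw_complex Y C d \<Phi> by fact
  fix n m :: nat
  assume nm: "n \<le> m" and y0: "y0 \<in> cw_skeleton C d \<Phi> m"
  show "relaxed_evaluation n Y y0 (subtopology Y (cw_skeleton C d \<Phi> m)) y0 id
      = homotopy_group n Y y0"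
  proof (rule relaxed_evaluation_full[OF _ y0])
    show "cw_skeleton C d \<Phi> m \<subseteq> topspace Y"
      unfolding cw_skeleton_def cells_cover by blast
  qed (rule cellular_approximation[OF _ nm y0])
next
  fix n :: nat
  have "relaxed_evaluation n Y y0 (subtopology Y (topspace Y)) y0 id = homotopy_group n Y y0"
  proof (rule relaxed_evaluation_full[OF order_refl \<open>y0 \<in> topspace Y\<close>])
    fix f assume "pointed_map (nsphere n) sphere_base Y y0 f"
    then show "\<exists>g. pointed_homotopic (nsphere n) sphere_base Y y0 f g \<and>
        g ` topspace (nsphere n) \<subseteq> topspace Y"
      using continuous_map_image_subset_topspace[of "nsphere n" Y f]
      by (intro exI[of _ f]) (auto simp: pointed_map_def pointed_homotopic_def)
  qed
  then show "relaxed_evaluation n Y y0 Y y0 id = homotopy_group n Y y0" by simp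
qed

end
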